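(* Let $s\ge 0$ and $\beta>0$, and suppose that $f_X$ satisfies the logarithmic source condition $$\rho:=\big\|\ell_s\cdot \mathcal{F}f_X\cdot|\ln(|\mathcal{F}f_\epsilon/\ell_s|^2)|^{\beta/2}\big\|<\infty .$$ Consider the estimator $\widetilde{f_X}_s$ with threshold $\alpha=c\cdot(\mathbb{E}\|\widehat{f_Y}-f_Y\|^2)^{1/2}$ for some $c>0$. Then there exists a constant $C>0$ depending only on $\rho$, $\beta$ and $c$ such that $$\mathbb{E}\|\widetilde{f_X}_s-f_X\|_s^2\le C\cdot\big|\log(\mathbb{E}\|\widehat{f_Y}-f_Y\|^2)\big|^{-\beta}\qquad\text{as }\mathbb{E}\|\widehat{f_Y}-f_Y\|^2\to0 .$$
   Context: $\|\cdot\|$ is the norm of $L^2(\mathbb{R})$ and $[\mathcal{F}g](t)=\frac{1}{\sqrt{2\pi}}\int_{-\infty}^\infty e^{-itx}g(x)\,dx$ for $g\in L^1(\mathbb{R})\cap L^2(\mathbb{R})$, extended as a unitary operator to $L^2(\mathbb{R})$. $\mathcal{D}$ is the set of all probability densities in $L^2(\mathbb{R})$. $X$ and $\epsilon$ are independent real random variables with densities $f_X,f_\epsilon\in\mathcal{D}$, with $|[\mathcal{F}f_\epsilon](t)|^2>0$ for all $t\in\mathbb{R}$; $Y=X+\epsilon$ has density $f_Y=f_X\star f_\epsilon$ (convolution). The density $f_\epsilon$ is known; $Y_1,\dots,Y_n$ is an i.i.d. sample from $f_Y$, and $\widehat{f_Y}$ is an estimator of $f_Y$ constructed from this sample, with values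 in $L^2(\mathbb{R})$. For $s\in\mathbb{R}$ let $\ell_s(t):=(1+t^2)^{s/2}$, and for $s\ge0$ let $\|f\|_s^2:=\int_{-\infty}^\infty(1+t^2)^s|[\mathcal{F}f](t)|^2\,dt$ (Sobolev norm). For a (deterministic) threshold $\alpha=\alpha(n)>0$ the estimator $\widetilde{f_X}_s$ is defined by $$\mathcal{F}\widetilde{f_X}_s:=\frac{\mathcal{F}\widehat{f_Y}\cdot\overline{\mathcal{F}f_\epsilon}}{\sqrt{2\pi}\,|\mathcal{F}f_\epsilon|^2}\cdot\mathbb{1}\{|\mathcal{F}f_\epsilon/\ell_s|^2\ge\alpha\}.$$ Both $\ln$ and $\log$ denote the natural logarithm. "As $\mathbb{E}\|\widehat{f_Y}-f_Y\|^2\to0$" means that the inequality holds whenever this quantity is sufficiently small. *)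

theory Defs
  imports "HOL-Probability.Probability"
begin

subsection \<open>The space \<open>L\<^sup>2(\<real>)\<close>\<close>

text \<open>Elements of \<open>L\<^sup>2(\<real>)\<close> are represented by Borel functions; equality in \<open>L\<^sup>2\<close> is equality
  almost everywhere. The squared norm is extended real valued, so that finiteness is never implicit.\<close>

definition L2_sq :: "(real \<Rightarrow> complex) \<Rightarrow> ennreal" where
  "L2_sq f = (\<integral>\<^sup>+x. ennreal ((cmod (f x))\<^sup>2) \<partial>lborel)"

definition L2 :: "(real \<Rightarrow> complex) set" where
  "L2 = {f. f \<in> borel_measurable borel \<and> L2_sq f < \<infinity>}"

text \<open>Only meaningful on \<^const>\<open>L2\<close> (outside, the value is 0).\<close>

definition L2_norm :: "(real \<Rightarrow> complex) \<Rightarrow> real" where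
  "L2_norm f = sqrt (enn2real (L2_sq f))"

subsection \<open>The Fourier transform\<close>

definition fourier_integral :: "(real \<Rightarrow> complex) \<Rightarrow> real \<Rightarrow> complex" where
  "fourier_integral f t =
     complex_of_real (1 / sqrt (2 * pi)) *
     (\<integral>x. exp (- (\<i> * complex_of_real t * complex_of_real x)) * f x \<partial>lborel)"

text \<open>\<open>g\<close> is a version of the transform of \<open>f \<in> L\<^sup>2\<close> under the continuous extension of
  \<^const>\<open>fourier_integral\<close> from \<open>L\<^sup>1 \<inter> L\<^sup>2\<close>.\<close>

definition is_L2_fourier :: "(real \<Rightarrow> complex) \<Rightarrow> (real \<Rightarrow> complex) \<Rightarrow> bool" where
  "is_L2_fourier f g \<longleftrightarrow> f \<in> L2 \<and> g \<in> L2 \<and>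
     (\<exists>h. (\<forall>n::nat. integrable lborel (h n) \<and> h n \<in> L2) \<and>
          (\<lambda>n. L2_sq (\<lambda>x. h n x - f x)) \<longlonglongrightarrow> 0 \<and>
          (\<lambda>n. L2_sq (\<lambda>t. fourier_integral (h n) t - g t)) \<longlonglongrightarrow> 0)"

text \<open>On integrable functions this is the everywhere defined (continuous) integral transform; on the
  remaining elements of \<open>L\<^sup>2\<close> it is some version of the extended transform, unique almost
  everywhere by Plancherel's theorem.\<close>

definition fourier :: "(real \<Rightarrow> complex) \<Rightarrow> real \<Rightarrow> complex" where
  "fourier f = (if integrable lborel f then fourier_integral f else (SOME g. is_L2_fourier f g))"

abbreviation fourier_real :: "(real \<Rightarrow> real) \<Rightarrow> real \<Rightarrow> complex" where
  "fourier_real f \<equiv> fourier (\<lambda>x. complex_of_real (f x))"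

subsection \<open>Sobolev norms\<close>

definition ell :: "real \<Rightarrow> real \<Rightarrow> real" where
  "ell s t = (1 + t\<^sup>2) powr (s / 2)"

definition sobolev_sq :: "real \<Rightarrow> (real \<Rightarrow> complex) \<Rightarrow> ennreal" where
  "sobolev_sq s f = (\<integral>\<^sup>+t. ennreal ((1 + t\<^sup>2) powr s * (cmod (fourier f t))\<^sup>2) \<partial>lborel)"

subsection \<open>The deconvolution model\<close>

definition L2_densities :: "(real \<Rightarrow> real) set" where
  "L2_densities = {f. f \<in> borel_measurable borel \<and> (AE x in lborel. 0 \<le> f x) \<and>
     (\<integral>\<^sup>+x. ennreal (f x) \<partial>lborel) = 1 \<and> (\<lambda>x. complex_of_real (f x)) \<in> L2}"

definition conv :: "(real \<Rightarrow> real) \<Rightarrow> (real \<Rightarrow> real) \<Rightarrow> real \<Rightarrow> real" where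
  "conv f g y = (\<integral>x. f (y - x) * g x \<partial>lborel)"

text \<open>The joint law of an i.i.d. sample \<open>Y\<^sub>0, \<dots>, Y\<^sub>n\<^sub>-\<^sub>1\<close> with density \<open>f\<close>. Expectations of functions of
  the sample are integrals with respect to this law (lemma \<open>nn_integral_iid_sample\<close> below).\<close>

definition sample_law :: "nat \<Rightarrow> (real \<Rightarrow> real) \<Rightarrow> (nat \<Rightarrow> real) measure" where
  "sample_law n f = (\<Pi>\<^sub>M i\<in>{..<n}. density lborel (\<lambda>x. ennreal (f x)))"

text \<open>An estimator assigns to every sample \<open>y\<close> an element \<open>T y\<close> of \<open>L\<^sup>2\<close>; joint measurability
  makes it an \<open>L\<^sup>2\<close>-valued random variable.\<close>

definition L2_estimator :: "nat \<Rightarrow> (real \<Rightarrow> real) \<Rightarrow> ((nat \<Rightarrow> real) \<Rightarrow> real \<Rightarrow> complex) \<Rightarrow> bool" where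
  "L2_estimator n f T \<longleftrightarrow>
     (\<lambda>(y, x). T y x) \<in> borel_measurable (sample_law n f \<Otimes>\<^sub>M lborel) \<and>
     (\<forall>y \<in> space (sample_law n f). T y \<in> L2)"

definition L2_risk :: "nat \<Rightarrow> (real \<Rightarrow> real) \<Rightarrow> ((nat \<Rightarrow> real) \<Rightarrow> real \<Rightarrow> complex) \<Rightarrow> ennreal" where
  "L2_risk n f T = (\<integral>\<^sup>+y. L2_sq (\<lambda>x. T y x - complex_of_real (f x)) \<partial>sample_law n f)"

text \<open>The law of the sample is that of \<open>f\<^sub>Y\<close>, while the target of estimation is \<open>f\<^sub>X\<close>.\<close>

definition sobolev_risk ::
  "real \<Rightarrow> nat \<Rightarrow> (real \<Rightarrow> real) \<Rightarrow> (real \<Rightarrow> real) \<Rightarrow> ((nat \<Rightarrow> real) \<Rightarrow> real \<Rightarrow> complex) \<Rightarrow> ennreal" where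
  "sobolev_risk s n fY fX T =
     (\<integral>\<^sup>+y. sobolev_sq s (\<lambda>x. T y x - complex_of_real (fX x)) \<partial>sample_law n fY)"

text \<open>\<open>h\<close> is the element of \<open>L\<^sup>2\<close> (unique up to null sets) whose Fourier transform is the spectral
  cut-off of the one of \<open>g\<close>.\<close>

definition is_spectral_cutoff ::
  "real \<Rightarrow> real \<Rightarrow> (real \<Rightarrow> real) \<Rightarrow> (real \<Rightarrow> complex) \<Rightarrow> (real \<Rightarrow> complex) \<Rightarrow> bool" where
  "is_spectral_cutoff s \<alpha> feps g h \<longleftrightarrow> h \<in> L2 \<and>
     (AE t in lborel. fourier h t =
        fourier g t * cnj (fourier_real feps t)
          / complex_of_real (sqrt (2 * pi) * (cmod (fourier_real feps t))\<^sup>2)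
        * indicator {u. (cmod (fourier_real feps u / complex_of_real (ell s u)))\<^sup>2 \<ge> \<alpha>} t)"

text \<open>The function whose \<open>L\<^sup>2\<close> norm is required to be finite by the logarithmic source condition.\<close>

definition source_fun :: "real \<Rightarrow> real \<Rightarrow> (real \<Rightarrow> real) \<Rightarrow> (real \<Rightarrow> real) \<Rightarrow> real \<Rightarrow> complex" where
  "source_fun s \<beta> feps fX t =
     complex_of_real (ell s t) * fourier_real fX t *
     complex_of_real
       (\<bar>ln ((cmod (fourier_real feps t / complex_of_real (ell s t)))\<^sup>2)\<bar> powr (\<beta> / 2))"

subsection \<open>Relation to random variables\<close>

lemma L2_densities_integrable_sq:
  assumes "f \<in> L2_densities"
  shows "integrable lborel (\<lambda>x. (f x)\<^sup>2)"
  using assms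
  by (intro integrableI_bounded) (auto simp: L2_densities_def L2_def L2_sq_def)

lemma (in prob_space) distributed_conv:
  assumes X: "distributed M lborel X (\<lambda>x. ennreal (fX x))"
    and eps: "distributed M lborel eps (\<lambda>x. ennreal (feps x))"
    and indep: "indep_var borel X borel eps"
    and dens: "fX \<in> L2_densities" "feps \<in> L2_densities"
  shows "distributed M lborel (\<lambda>\<omega>. X \<omega> + eps \<omega>) (\<lambda>y. ennreal (conv fX feps y))"
proof -
  have [measurable]: "fX \<in> borel_measurable borel" "feps \<in> borel_measurable borel"
    and nn: "AE x in lborel. 0 \<le> fX x" "AE x in lborel. 0 \<le> feps x"
    using dens by (auto simp: L2_densities_def)
  have eq: "(\<integral>\<^sup>+x. ennreal (fX (y - x)) * ennreal (feps x) \<partial>lborel) = ennreal (conv fX feps y)" for y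
  proof -
    have nn': "AE x in lborel. 0 \<le> fX (y - x)"
      using AE_borel_affine[of "-1" "\<lambda>x. 0 \<le> fX x" y] nn(1) by simp
    have "integrable lborel (\<lambda>x. (fX (y + (-1) * x))\<^sup>2)"
      by (rule lborel_integrable_real_affine[OF L2_densities_integrable_sq[OF dens(1)]]) simp
    then have int: "integrable lborel (\<lambda>x. (fX (y - x))\<^sup>2 + (feps x)\<^sup>2)"
      using L2_densities_integrable_sq[OF dens(2)] by simp
    have "integrable lborel (\<lambda>x. fX (y - x) * feps x)"
    proof (rule Bochner_Integration.integrable_bound[OF int])
      have "\<bar>a * b\<bar> \<le> a\<^sup>2 + b\<^sup>2" for a b :: real
      proof -
        have "0 \<le> (\<bar>a\<bar> - \<bar>b\<bar>)\<^sup>2" by simp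
        then have "2 * \<bar>a * b\<bar> \<le> a\<^sup>2 + b\<^sup>2"
          by (simp add: power2_diff abs_mult)
        then show ?thesis by (smt (verit) abs_ge_zero)
      qed
      then show "AE x in lborel. norm (fX (y - x) * feps x) \<le> norm ((fX (y - x))\<^sup>2 + (feps x)\<^sup>2)"
        by simp
    qed simp
    moreover have "AE x in lborel. 0 \<le> fX (y - x) * feps x"
      using nn' nn(2) by eventually_elim simp
    ultimately have "(\<integral>\<^sup>+x. ennreal (fX (y - x) * feps x) \<partial>lborel) = ennreal (conv fX feps y)"
      unfolding conv_def by (rule nn_integral_eq_integral)
    moreover have "(\<integral>\<^sup>+x. ennreal (fX (y - x)) * ennreal (feps x) \<partial>lborel) =
        (\<integral>\<^sup>+x. ennreal (fX (y - x) * feps x) \<partial>lborel)"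
      using nn' by (intro nn_integral_cong_AE) (auto simp: ennreal_mult')
    ultimately show ?thesis by simp
  qed
  show ?thesis
    by (rule distributed_convolution[OF indep X eps, unfolded eq])
qed

lemma (in prob_space) nn_integral_iid_sample:
  assumes indep: "indep_vars (\<lambda>_. borel) Y {..<n}"
    and Y: "\<And>i. i < n \<Longrightarrow> distributed M lborel (Y i) (\<lambda>x. ennreal (f x))"
    and F: "F \<in> borel_measurable (sample_law n f)"
  shows "(\<integral>\<^sup>+\<omega>. F (\<lambda>i\<in>{..<n}. Y i \<omega>) \<partial>M) = (\<integral>\<^sup>+y. F y \<partial>sample_law n f)"
proof -
  have rv: "random_variable borel (Y i)" if "i \<in> {..<n}" for i
    using indep that by (auto simp: indep_vars_def)
  have d: "distr M borel (Y i) = density lborel (\<lambda>x. ennreal (f x))" if "i < n" for i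
    using distributed_distr_eq_density[OF Y[OF that]] by (simp cong: distr_cong)
  have law: "distr M (\<Pi>\<^sub>M i\<in>{..<n}. borel) (\<lambda>\<omega>. \<lambda>i\<in>{..<n}. Y i \<omega>) = sample_law n f"
  proof (cases "n = 0")
    case False
    have "distr M (\<Pi>\<^sub>M i\<in>{..<n}. borel) (\<lambda>\<omega>. \<lambda>i\<in>{..<n}. Y i \<omega>) = (\<Pi>\<^sub>M i\<in>{..<n}. distr M borel (Y i))"
      using indep indep_vars_iff_distr_eq_PiM'[of "{..<n}" Y "\<lambda>_. borel"] False rv by auto
    also have "\<dots> = sample_law n f"
      unfolding sample_law_def using d by (intro PiM_cong) auto
    finally show ?thesis .
  next
    case True
    have "distr M (count_space {\<lambda>_. undefined}) (\<lambda>\<omega>. \<lambda>_. undefined) =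
        count_space {\<lambda>_::nat. undefined::real}"
      by (intro measure_eqI)
        (auto simp: emeasure_distr subset_singleton_iff emeasure_space_1)
    then show ?thesis
      using True by (simp add: sample_law_def PiM_empty restrict_def)
  qed
  have m1: "(\<lambda>\<omega>. \<lambda>i\<in>{..<n}. Y i \<omega>) \<in> M \<rightarrow>\<^sub>M (\<Pi>\<^sub>M i\<in>{..<n}. borel)"
    using rv by (intro measurable_restrict) auto
  have m2: "F \<in> borel_measurable
      (distr M (\<Pi>\<^sub>M i\<in>{..<n}. borel) (\<lambda>\<omega>. \<lambda>i\<in>{..<n}. Y i \<omega>))"
    unfolding law by (rule F)
  show ?thesis
    unfolding law[symmetric] by (rule nn_integral_distr[OF m1 m2, symmetric])
qed

end

theory Submission
  imports Defs "HOL-Real_Asymp.Real_Asymp"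
begin

text \<open>The rate is a bias-variance estimate on the Fourier side. Write \<open>e\<close>, \<open>x\<close>, \<open>d\<close> for the values at
  a frequency \<open>t\<close> of the transforms of \<open>f\<^sub>\<epsilon>\<close>, \<open>f\<^sub>X\<close> and of the estimate of \<open>f\<^sub>Y\<close>, and
  \<open>p = |e / \<ell>\<^sub>s|\<^sup>2\<close>. By the convolution theorem the transform of \<open>f\<^sub>Y\<close> is \<open>\<surd>(2\<pi>) x e\<close>. Where \<open>p \<ge> \<alpha>\<close>,
  the squared error with the Sobolev weight is the squared error of \<open>d\<close> times
  \<open>1 / (2\<pi>p) \<le> 1 / (2\<pi>\<alpha>)\<close>. Where \<open>p < \<alpha> < 1\<close>, the estimator vanishes and the weighted squared
  error is \<open>\<ell>\<^sub>s\<^sup>2 |x|\<^sup>2\<close>, which is the integrand of the source condition divided by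
  \<open>|ln p|\<^sup>\<beta> \<ge> |ln \<alpha>|\<^sup>\<beta>\<close>. Integrating over the frequency and over the sample, with \<open>\<Delta>\<close> the risk of
  the estimator of \<open>f\<^sub>Y\<close>, gives the bound
  \<open>\<Delta> / (2\<pi>\<alpha>) + \<rho>\<^sup>2 |ln \<alpha>|\<^sup>-\<^sup>\<beta>\<close>; for \<open>\<alpha> = c \<surd>\<Delta>\<close> the first term is of order \<open>\<surd>\<Delta>\<close>, hence
  negligible, and \<open>|ln \<alpha>|\<close> is comparable to \<open>|ln \<Delta>|\<close>. The two regimes are
  \<open>cutoff_error_on_window\<close> and \<open>cutoff_error_off_window\<close>, and they are combined in
  \<open>spectral_cutoff_sobolev_le\<close> and \<open>sobolev_risk_le\<close>.

  What is needed from Fourier analysis is that the extension of the transform to \<open>L\<^sup>2\<close> exists, is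
  linear almost everywhere and satisfies \<open>\<parallel>\<F>f\<parallel> \<le> \<parallel>f\<parallel>\<close>. This contraction property is the half of
  Plancherel's theorem that bounds errors from above, and it makes the extension unique almost
  everywhere. On \<open>L\<^sup>1 \<inter> L\<^sup>2\<close> it follows by inserting a Gaussian weight into \<open>\<integral>|\<F>h|\<^sup>2\<close>: two
  applications of the multiplication formula
  \<open>\<integral> (\<F>f) g = \<integral> f (\<F>g)\<close> turn the weighted integral into
  \<open>\<integral>\<integral> h(x) cnj(h(y)) G(x - y) dx dy\<close> with a Gaussian density \<open>G\<close>, which is at most \<open>\<parallel>h\<parallel>\<^sup>2\<close> as \<open>G\<close> has
  mass one; Fatou's lemma removes the weight (\<open>fourier_integral_L2_contraction\<close>).\<close>

section \<open>The Fourier integral of integrable functions\<close>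

lemma borel_measurable_fourier_integral [measurable]:
  assumes [measurable]: "f \<in> borel_measurable borel"
  shows "fourier_integral f \<in> borel_measurable borel"
  unfolding fourier_integral_def by measurable

lemma borel_measurable_cnj [measurable (raw)]:
  assumes "f \<in> borel_measurable M"
  shows "(\<lambda>x. cnj (f x)) \<in> borel_measurable M"
  using assms by (rule borel_measurable_continuous_on[OF continuous_on_cnj[OF continuous_on_id]])

lemma norm_exp_ii [simp]:
  "cmod (exp (- (\<i> * complex_of_real t * complex_of_real x))) = 1"
  using norm_exp_i_times[of "- (t * x)"] by (simp add: mult.assoc)

lemma integrable_exp_ii_mult:
  assumes "integrable lborel f"
  shows "integrable lborel (\<lambda>x. exp (- (\<i> * complex_of_real t * complex_of_real x)) * f x)"
proof -
  have [measurable]: "f \<in> borel_measurable borel"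
    using borel_measurable_integrable[OF assms] by simp
  show ?thesis
    by (rule Bochner_Integration.integrable_bound[OF assms]) (auto simp: norm_mult)
qed

lemma fourier_integral_diff:
  assumes "integrable lborel f" "integrable lborel g"
  shows "fourier_integral (\<lambda>x. f x - g x) t = fourier_integral f t - fourier_integral g t"
  unfolding fourier_integral_def
  using integrable_exp_ii_mult[OF assms(1), of t] integrable_exp_ii_mult[OF assms(2), of t]
  by (simp add: right_diff_distrib Bochner_Integration.integral_diff)

lemma norm_fourier_integral_le:
  "cmod (fourier_integral f t) \<le> 1 / sqrt (2 * pi) * (\<integral>x. cmod (f x) \<partial>lborel)"
proof -
  have "cmod (\<integral>x. exp (- (\<i> * complex_of_real t * complex_of_real x)) * f x \<partial>lborel)
      \<le> (\<integral>x. cmod (exp (- (\<i> * complex_of_real t * complex_of_real x)) * f x) \<partial>lborel)"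
    by (rule integral_norm_bound)
  then show ?thesis
    unfolding fourier_integral_def norm_mult[of "complex_of_real _"] norm_of_real
    by (simp add: norm_mult divide_right_mono)
qed

text \<open>Fubini's theorem, with integrability on the plane replaced by finiteness of an iterated
  extended integral, which Tonelli's theorem lets one compute one variable at a time.\<close>

lemma lborel_integral_swap:
  fixes f :: "real \<Rightarrow> real \<Rightarrow> complex"
  assumes [measurable]: "case_prod f \<in> borel_measurable (lborel \<Otimes>\<^sub>M lborel)"
    and fin: "(\<integral>\<^sup>+x. \<integral>\<^sup>+y. ennreal (cmod (f x y)) \<partial>lborel \<partial>lborel) < \<infinity>"
  shows "(\<integral>x. \<integral>y. f x y \<partial>lborel \<partial>lborel) = (\<integral>y. \<integral>x. f x y \<partial>lborel \<partial>lborel)"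
proof -
  have "(\<integral>\<^sup>+p. ennreal (norm (case_prod f p)) \<partial>(lborel \<Otimes>\<^sub>M lborel)) < \<infinity>"
    using fin by (subst lborel.nn_integral_fst[symmetric]) simp_all
  then have "integrable (lborel \<Otimes>\<^sub>M lborel) (case_prod f)"
    by (intro integrableI_bounded) auto
  from lborel_pair.Fubini_integral[OF this] show ?thesis by simp
qed

text \<open>Both sides are the double integral of \<open>(2\<pi>)\<^sup>-\<^sup>1\<^sup>/\<^sup>2 e\<^sup>-\<^sup>i\<^sup>t\<^sup>x f(x) g(t)\<close>.\<close>

lemma fourier_multiplication_formula:
  assumes f: "integrable lborel f" and g: "integrable lborel g"
  shows "(\<integral>t. fourier_integral f t * g t \<partial>lborel) = (\<integral>x. f x * fourier_integral g x \<partial>lborel)"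
proof -
  have [measurable]: "f \<in> borel_measurable borel" "g \<in> borel_measurable borel"
    using f g by (auto dest: borel_measurable_integrable)
  define k where "k t x = complex_of_real (1 / sqrt (2 * pi)) *
    (exp (- (\<i> * complex_of_real t * complex_of_real x)) * f x * g t)" for t x
  have fin: "(\<integral>\<^sup>+x. ennreal (cmod (f x)) \<partial>lborel) < \<infinity>" "(\<integral>\<^sup>+x. ennreal (cmod (g x)) \<partial>lborel) < \<infinity>"
    using f g by (auto simp: integrable_iff_bounded)
  have "(\<integral>\<^sup>+t. \<integral>\<^sup>+x. ennreal (cmod (k t x)) \<partial>lborel \<partial>lborel) =
      (\<integral>\<^sup>+t. \<integral>\<^sup>+x. ennreal (1 / sqrt (2 * pi)) * (ennreal (cmod (g t)) * ennreal (cmod (f x))) \<partial>lborel \<partial>lborel)"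
    unfolding k_def norm_mult norm_of_real norm_exp_ii by (simp add: ennreal_mult'[symmetric] mult_ac)
  also have "\<dots> = ennreal (1 / sqrt (2 * pi)) * ((\<integral>\<^sup>+t. ennreal (cmod (g t)) \<partial>lborel) * (\<integral>\<^sup>+x. ennreal (cmod (f x)) \<partial>lborel))"
    by (simp add: nn_integral_cmult nn_integral_multc)
  also have "\<dots> < \<infinity>"
    using fin by (simp add: ennreal_mult_less_top)
  finally have swap: "(\<integral>t. \<integral>x. k t x \<partial>lborel \<partial>lborel) = (\<integral>x. \<integral>t. k t x \<partial>lborel \<partial>lborel)"
    by (intro lborel_integral_swap) (simp add: k_def case_prod_beta)
  have "(\<integral>x. k t x \<partial>lborel) = fourier_integral f t * g t" for t
  proof -
    have "k t x = (complex_of_real (1 / sqrt (2 * pi)) * g t) *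
        (exp (- (\<i> * complex_of_real t * complex_of_real x)) * f x)" for x
      unfolding k_def by (simp only: mult_ac)
    then show ?thesis
      unfolding fourier_integral_def by (simp only: integral_mult_right_zero) (simp only: mult_ac)
  qed
  moreover have "(\<integral>t. k t x \<partial>lborel) = f x * fourier_integral g x" for x
  proof -
    have "k t x = complex_of_real (1 / sqrt (2 * pi)) * f x * (exp (- (\<i> * complex_of_real x * complex_of_real t)) * g t)" for t
      unfolding k_def by (simp only: mult_ac)
    then show ?thesis
      unfolding fourier_integral_def by (simp only: integral_mult_right_zero) (simp only: mult_ac)
  qed
  ultimately show ?thesis using swap by simp
qed

lemma fourier_integral_modulate:
  "fourier_integral (\<lambda>t. exp (- (\<i> * complex_of_real x * complex_of_real t)) * f t) y =
     fourier_integral f (x + y)"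
proof -
  have "exp (- (\<i> * complex_of_real y * complex_of_real t)) *
      (exp (- (\<i> * complex_of_real x * complex_of_real t)) * f t) =
      exp (- (\<i> * complex_of_real (x + y) * complex_of_real t)) * f t" for t
  proof -
    have "- (\<i> * complex_of_real (x + y) * complex_of_real t) =
        - (\<i> * complex_of_real y * complex_of_real t) + - (\<i> * complex_of_real x * complex_of_real t)"
      by (simp add: algebra_simps)
    then show ?thesis by (simp only: exp_add mult.assoc)
  qed
  then show ?thesis unfolding fourier_integral_def by (simp only:)
qed

lemma cnj_fourier_integral:
  "cnj (fourier_integral f t) = fourier_integral (\<lambda>x. cnj (f (- x))) t"
proof -
  have "cnj (\<integral>x. exp (- (\<i> * complex_of_real t * complex_of_real x)) * f x \<partial>lborel) =
      (\<integral>x. cnj (exp (- (\<i> * complex_of_real t * complex_of_real x)) * f x) \<partial>lborel)"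
    by (rule Bochner_Integration.integral_cnj[symmetric])
  also have "\<dots> = (\<integral>x. exp (- (\<i> * complex_of_real t * complex_of_real x)) * cnj (f (- x)) \<partial>lborel)"
    by (subst lborel_integral_real_affine[of "-1" _ 0]) (simp_all add: exp_cnj)
  finally show ?thesis
    unfolding fourier_integral_def by simp
qed

section \<open>Contraction in \<open>L\<^sup>2\<close> by Gaussian regularisation\<close>

definition gauss_weight :: "real \<Rightarrow> real \<Rightarrow> real" where
  "gauss_weight \<tau> t = exp (- (t / \<tau>)\<^sup>2 / 2)"

lemma borel_measurable_gauss_weight [measurable]: "gauss_weight \<tau> \<in> borel_measurable borel"
  unfolding gauss_weight_def by measurable

lemma gauss_weight_eq:
  assumes "\<tau> > 0"
  shows "gauss_weight \<tau> t = sqrt (2 * pi) * \<tau> * normal_density 0 \<tau> t"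
  using assms by (simp add: gauss_weight_def normal_density_def real_sqrt_mult power_divide mult.commute)

lemma integrable_gauss_weight:
  assumes "\<tau> > 0"
  shows "integrable lborel (gauss_weight \<tau>)"
  unfolding gauss_weight_eq[OF assms, abs_def]
  using assms by (intro integrable_mult_right integrable_normal_density)

text \<open>After the substitution \<open>x \<mapsto> \<tau> x\<close> this is the characteristic function of the standard normal
  distribution. A wide weight has as its transform a multiple of a narrow normal density.\<close>

lemma fourier_integral_gauss_weight:
  assumes "\<tau> > 0"
  shows "fourier_integral (\<lambda>t. complex_of_real (gauss_weight \<tau> t)) z =
    complex_of_real (sqrt (2 * pi) * normal_density 0 (1 / \<tau>) z)"
proof -
  have "(\<integral>x. exp (- (\<i> * complex_of_real z * complex_of_real x)) * complex_of_real (gauss_weight \<tau> x) \<partial>lborel)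
     = \<tau> *\<^sub>R (\<integral>x. exp (- (\<i> * complex_of_real z * complex_of_real (\<tau> * x))) *
          complex_of_real (gauss_weight \<tau> (\<tau> * x)) \<partial>lborel)"
    using assms by (subst lborel_integral_real_affine[of \<tau> _ 0]) simp_all
  also have "(\<integral>x. exp (- (\<i> * complex_of_real z * complex_of_real (\<tau> * x))) *
          complex_of_real (gauss_weight \<tau> (\<tau> * x)) \<partial>lborel) =
      (\<integral>x. complex_of_real (sqrt (2 * pi)) * (std_normal_density x *\<^sub>R iexp ((- (\<tau> * z)) * x)) \<partial>lborel)"
    using assms by (intro Bochner_Integration.integral_cong)
      (simp_all add: gauss_weight_def std_normal_density_def scaleR_conv_of_real mult_ac)
  also have "\<dots> = complex_of_real (sqrt (2 * pi)) * char std_normal_distribution (- (\<tau> * z))"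
    unfolding char_def integral_mult_right_zero by (simp add: integral_density)
  also have "\<dots> = complex_of_real (sqrt (2 * pi) * exp (- (\<tau> * z)\<^sup>2 / 2))"
    by (simp add: char_std_normal_distribution)
  finally have "fourier_integral (\<lambda>t. complex_of_real (gauss_weight \<tau> t)) z =
      complex_of_real (\<tau> * exp (- (\<tau> * z)\<^sup>2 / 2))"
    by (simp add: fourier_integral_def scaleR_conv_of_real mult_ac)
  also have "\<tau> * exp (- (\<tau> * z)\<^sup>2 / 2) = sqrt (2 * pi) * normal_density 0 (1 / \<tau>) z"
    using assms by (simp add: normal_density_def real_sqrt_divide real_sqrt_mult power_mult_distrib
      power_divide mult_ac)
  finally show ?thesis .
qed

lemma borel_measurable_L2: "f \<in> L2 \<Longrightarrow> f \<in> borel_measurable borel"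
  by (simp add: L2_def)

text \<open>Schur's test for a convolution kernel of mass one: use
  \<open>|h(x)| |h(y)| \<le> (|h(x)|\<^sup>2 + |h(y)|\<^sup>2) / 2\<close> and integrate the kernel over the variable that is free
  in each of the two terms.\<close>

lemma nn_integral_bilinear_le_L2_sq:
  assumes [measurable]: "h \<in> borel_measurable borel" "G \<in> borel_measurable borel"
    and G0: "\<And>x. 0 \<le> G x" and G1: "(\<integral>\<^sup>+x. ennreal (G x) \<partial>lborel) = 1"
  shows "(\<integral>\<^sup>+x. \<integral>\<^sup>+y. ennreal (cmod (h x) * G (x - y) * cmod (h y)) \<partial>lborel \<partial>lborel) \<le> L2_sq h"
proof -
  have mass: "(\<integral>\<^sup>+y. ennreal (G (x - y)) \<partial>lborel) = 1" "(\<integral>\<^sup>+y. ennreal (G (y - x)) \<partial>lborel) = 1" for x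
    using G1 nn_integral_real_affine[of "\<lambda>x. ennreal (G x)" "-1" x]
      nn_integral_real_affine[of "\<lambda>x. ennreal (G x)" 1 "-x"] by simp_all
  have "(\<integral>\<^sup>+x. \<integral>\<^sup>+y. ennreal (cmod (h x) * G (x - y) * cmod (h y)) \<partial>lborel \<partial>lborel) \<le>
     (\<integral>\<^sup>+x. \<integral>\<^sup>+y. ennreal ((cmod (h x))\<^sup>2 / 2) * ennreal (G (x - y)) +
        ennreal ((cmod (h y))\<^sup>2 / 2) * ennreal (G (x - y)) \<partial>lborel \<partial>lborel)"
  proof (intro nn_integral_mono)
    fix x y
    have "0 \<le> (cmod (h x) - cmod (h y))\<^sup>2 * G (x - y)"
      using G0 by simp
    then have "cmod (h x) * G (x - y) * cmod (h y) \<le>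
        (cmod (h x))\<^sup>2 / 2 * G (x - y) + (cmod (h y))\<^sup>2 / 2 * G (x - y)"
      by (simp add: power2_eq_square algebra_simps)
    then show "ennreal (cmod (h x) * G (x - y) * cmod (h y)) \<le>
        ennreal ((cmod (h x))\<^sup>2 / 2) * ennreal (G (x - y)) +
        ennreal ((cmod (h y))\<^sup>2 / 2) * ennreal (G (x - y))"
      using G0 by (simp add: ennreal_mult'[symmetric] ennreal_plus[symmetric] del: ennreal_plus)
  qed
  also have "\<dots> = (\<integral>\<^sup>+x. \<integral>\<^sup>+y. ennreal ((cmod (h x))\<^sup>2 / 2) * ennreal (G (x - y)) \<partial>lborel \<partial>lborel) +
      (\<integral>\<^sup>+x. \<integral>\<^sup>+y. ennreal ((cmod (h y))\<^sup>2 / 2) * ennreal (G (x - y)) \<partial>lborel \<partial>lborel)"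
    by (simp add: nn_integral_add)
  also have "(\<integral>\<^sup>+x. \<integral>\<^sup>+y. ennreal ((cmod (h y))\<^sup>2 / 2) * ennreal (G (x - y)) \<partial>lborel \<partial>lborel) =
      (\<integral>\<^sup>+y. \<integral>\<^sup>+x. ennreal ((cmod (h y))\<^sup>2 / 2) * ennreal (G (x - y)) \<partial>lborel \<partial>lborel)"
    by (rule lborel_pair.Fubini'[symmetric]) simp
  also have "(\<integral>\<^sup>+x. \<integral>\<^sup>+y. ennreal ((cmod (h x))\<^sup>2 / 2) * ennreal (G (x - y)) \<partial>lborel \<partial>lborel) +
      (\<integral>\<^sup>+y. \<integral>\<^sup>+x. ennreal ((cmod (h y))\<^sup>2 / 2) * ennreal (G (x - y)) \<partial>lborel \<partial>lborel) =
      (\<integral>\<^sup>+x. ennreal ((cmod (h x))\<^sup>2 / 2) \<partial>lborel) + (\<integral>\<^sup>+x. ennreal ((cmod (h x))\<^sup>2 / 2) \<partial>lborel)"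
    by (simp add: nn_integral_cmult mass)
  also have "\<dots> = L2_sq h"
    unfolding L2_sq_def by (subst nn_integral_add[symmetric]) (simp_all add: ennreal_plus[symmetric] del: ennreal_plus)
  finally show ?thesis .
qed

lemma norm_integral_le_nn_integral:
  fixes f :: "'a \<Rightarrow> 'b :: {banach, second_countable_topology}"
  shows "ennreal (norm (integral\<^sup>L M f)) \<le> (\<integral>\<^sup>+x. ennreal (norm (f x)) \<partial>M)"
  by (cases "integrable M f") (simp_all add: integral_norm_bound_ennreal not_integrable_integral_eq)

text \<open>The integral on the left is \<open>\<integral> (\<F>h) (w cnj(\<F>h))\<close>, and \<open>w cnj(\<F>h)\<close> is integrable because of the
  weight, so the multiplication formula moves the first transform onto it. As \<open>cnj(\<F>h)\<close> is itself the
  transform of \<open>y \<mapsto> cnj(h(-y))\<close>, a second use of the formula evaluates the transform of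
  \<open>w cnj(\<F>h)\<close> as the convolution of \<open>cnj h\<close> with a normal density.\<close>

lemma gauss_weighted_energy_le:
  assumes h: "integrable lborel h" and \<tau>: "\<tau> > 0"
  shows "(\<integral>\<^sup>+t. ennreal (gauss_weight \<tau> t * (cmod (fourier_integral h t))\<^sup>2) \<partial>lborel) \<le> L2_sq h"
proof -
  let ?w = "\<lambda>t. complex_of_real (gauss_weight \<tau> t)"
  let ?F = "fourier_integral h"
  let ?G = "normal_density 0 (1 / \<tau>)"
  have [measurable]: "h \<in> borel_measurable borel"
    using h by (auto dest: borel_measurable_integrable)
  obtain B where B: "\<And>t. cmod (?F t) \<le> B"
    using norm_fourier_integral_le by blast
  have B0: "0 \<le> B" using B[of 0] norm_ge_zero order_trans by blast
  have w0: "0 \<le> gauss_weight \<tau> t" for t by (simp add: gauss_weight_def)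
  have w: "integrable lborel ?w"
    using integrable_gauss_weight[OF \<tau>] by simp
  have intg: "integrable lborel (\<lambda>t. gauss_weight \<tau> t * (cmod (?F t))\<^sup>2)"
    using B B0 w0 by (intro Bochner_Integration.integrable_bound[OF integrable_mult_left[OF integrable_gauss_weight[OF \<tau>], of "B\<^sup>2"]])
      (auto intro!: mult_left_mono power_mono simp: abs_mult)
  have wF: "integrable lborel (\<lambda>t. ?w t * cnj (?F t))"
    using B B0 w0 by (intro Bochner_Integration.integrable_bound[OF integrable_mult_left[OF integrable_gauss_weight[OF \<tau>], of B]])
      (auto intro!: mult_left_mono simp: norm_mult)
  have h': "integrable lborel (\<lambda>y. cnj (h (- y)))"
    using lborel_integrable_real_affine[OF h, of "-1" 0] by simp
  have inner: "fourier_integral (\<lambda>t. ?w t * cnj (?F t)) x = (\<integral>y. complex_of_real (?G (x - y)) * cnj (h y) \<partial>lborel)" for x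
  proof -
    have "fourier_integral (\<lambda>t. ?w t * cnj (?F t)) x =
        complex_of_real (1 / sqrt (2 * pi)) * (\<integral>t. fourier_integral (\<lambda>y. cnj (h (- y))) t *
          (exp (- (\<i> * complex_of_real x * complex_of_real t)) * ?w t) \<partial>lborel)"
      by (simp only: fourier_integral_def[of "\<lambda>t. ?w t * cnj (?F t)"]) (simp only: cnj_fourier_integral mult_ac)
    also have "\<dots> = complex_of_real (1 / sqrt (2 * pi)) *
        (\<integral>y. cnj (h (- y)) * fourier_integral ?w (x + y) \<partial>lborel)"
      by (simp add: fourier_multiplication_formula[OF h' integrable_exp_ii_mult[OF w]] fourier_integral_modulate)
    also have "\<dots> = (\<integral>y. complex_of_real (?G (x + y)) * cnj (h (- y)) \<partial>lborel)"
      by (subst integral_mult_right_zero[symmetric]) (simp add: fourier_integral_gauss_weight[OF \<tau>] mult_ac)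
    also have "\<dots> = (\<integral>y. complex_of_real (?G (x - y)) * cnj (h y) \<partial>lborel)"
      by (subst lborel_integral_real_affine[of "-1" _ 0]) simp_all
    finally show ?thesis .
  qed
  have "complex_of_real (\<integral>t. gauss_weight \<tau> t * (cmod (?F t))\<^sup>2 \<partial>lborel) =
      (\<integral>t. ?F t * (?w t * cnj (?F t)) \<partial>lborel)"
    by (subst integral_complex_of_real[symmetric], intro Bochner_Integration.integral_cong refl)
      (simp only: of_real_mult complex_norm_square mult_ac)
  also have "\<dots> = (\<integral>x. h x * (\<integral>y. complex_of_real (?G (x - y)) * cnj (h y) \<partial>lborel) \<partial>lborel)"
    by (simp add: fourier_multiplication_formula[OF h wF] inner)
  finally have eq: "complex_of_real (\<integral>t. gauss_weight \<tau> t * (cmod (?F t))\<^sup>2 \<partial>lborel) = \<dots>" .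
  have nn: "(\<integral>t. gauss_weight \<tau> t * (cmod (?F t))\<^sup>2 \<partial>lborel) \<ge> 0"
    using w0 by (intro integral_nonneg_AE) auto
  have "(\<integral>\<^sup>+t. ennreal (gauss_weight \<tau> t * (cmod (?F t))\<^sup>2) \<partial>lborel) =
      ennreal (\<integral>t. gauss_weight \<tau> t * (cmod (?F t))\<^sup>2 \<partial>lborel)"
    using w0 by (intro nn_integral_eq_integral intg) auto
  also have "\<dots> = ennreal (cmod (\<integral>x. h x * (\<integral>y. complex_of_real (?G (x - y)) * cnj (h y) \<partial>lborel) \<partial>lborel))"
    unfolding eq[symmetric] using nn by simp
  also have "\<dots> \<le> (\<integral>\<^sup>+x. ennreal (cmod (h x * (\<integral>y. complex_of_real (?G (x - y)) * cnj (h y) \<partial>lborel))) \<partial>lborel)"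
    by (rule norm_integral_le_nn_integral)
  also have "\<dots> \<le> (\<integral>\<^sup>+x. \<integral>\<^sup>+y. ennreal (cmod (h x) * ?G (x - y) * cmod (h y)) \<partial>lborel \<partial>lborel)"
  proof (rule nn_integral_mono)
    fix x
    have "ennreal (cmod (h x * (\<integral>y. complex_of_real (?G (x - y)) * cnj (h y) \<partial>lborel))) \<le>
       ennreal (cmod (h x)) * (\<integral>\<^sup>+y. ennreal (cmod (complex_of_real (?G (x - y)) * cnj (h y))) \<partial>lborel)"
      unfolding norm_mult[of "h x"] by (subst ennreal_mult') (auto intro!: mult_left_mono norm_integral_le_nn_integral)
    also have "\<dots> = (\<integral>\<^sup>+y. ennreal (cmod (h x) * ?G (x - y) * cmod (h y)) \<partial>lborel)"
      by (subst nn_integral_cmult[symmetric]) (auto simp: norm_mult ennreal_mult'[symmetric] mult.assoc)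
    finally show "ennreal (cmod (h x * (\<integral>y. complex_of_real (?G (x - y)) * cnj (h y) \<partial>lborel))) \<le>
       (\<integral>\<^sup>+y. ennreal (cmod (h x) * ?G (x - y) * cmod (h y)) \<partial>lborel)" .
  qed
  also have "\<dots> \<le> L2_sq h"
  proof (rule nn_integral_bilinear_le_L2_sq)
    have "integrable lborel ?G" "(\<integral>x. ?G x \<partial>lborel) = 1" using \<tau> by simp_all
    then show "(\<integral>\<^sup>+x. ennreal (?G x) \<partial>lborel) = 1"
      by (subst nn_integral_eq_integral) simp_all
  qed simp_all
  finally show ?thesis .
qed

text \<open>The weights tend to \<open>1\<close> as \<open>\<tau>\<close> grows, and the bound on the weighted integrals does not depend on
  \<open>\<tau>\<close>.\<close>

lemma fourier_integral_L2_contraction: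
  assumes h: "integrable lborel h"
  shows "L2_sq (fourier_integral h) \<le> L2_sq h"
proof -
  let ?F = "fourier_integral h"
  have [measurable]: "h \<in> borel_measurable borel"
    using h by (auto dest: borel_measurable_integrable)
  have lim: "(\<lambda>n. ennreal (gauss_weight (real (Suc n)) t * (cmod (?F t))\<^sup>2)) \<longlonglongrightarrow> ennreal ((cmod (?F t))\<^sup>2)" for t
  proof -
    have "(\<lambda>n. gauss_weight (real (Suc n)) t) \<longlonglongrightarrow> 1"
    proof -
      have "(\<lambda>n. t / real (Suc n)) \<longlonglongrightarrow> 0"
        using LIMSEQ_Suc[OF lim_const_over_n[of t]] by simp
      then have "(\<lambda>n. exp (- (t / real (Suc n))\<^sup>2 / 2)) \<longlonglongrightarrow> exp (- 0\<^sup>2 / 2)"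
        by (intro tendsto_intros) auto
      then show ?thesis by (simp add: gauss_weight_def)
    qed
    from tendsto_mult_right[OF this, of "(cmod (?F t))\<^sup>2"] show ?thesis
      by (intro tendsto_ennrealI) simp
  qed
  have "L2_sq ?F = (\<integral>\<^sup>+t. liminf (\<lambda>n. ennreal (gauss_weight (real (Suc n)) t * (cmod (?F t))\<^sup>2)) \<partial>lborel)"
    unfolding L2_sq_def by (intro nn_integral_cong lim_imp_Liminf[OF _ lim, symmetric]) simp
  also have "\<dots> \<le> liminf (\<lambda>n. \<integral>\<^sup>+t. ennreal (gauss_weight (real (Suc n)) t * (cmod (?F t))\<^sup>2) \<partial>lborel)"
    by (intro nn_integral_liminf) measurable
  also have "\<dots> \<le> liminf (\<lambda>n::nat. L2_sq h)"
    by (intro Liminf_mono always_eventually allI gauss_weighted_energy_le h) simp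
  finally show ?thesis by (simp add: Liminf_const)
qed

section \<open>Convergence in \<open>L\<^sup>2\<close>\<close>

lemma L2_sq_diff_commute: "L2_sq (\<lambda>x. f x - g x) = L2_sq (\<lambda>x. g x - f x)"
  by (simp add: L2_sq_def norm_minus_commute)

text \<open>This form of the triangle inequality for squared norms, with a free parameter, loses an
  arbitrarily small factor on one summand and works in the extended reals without square roots.\<close>

lemma L2_sq_add_le:
  assumes [measurable]: "f \<in> borel_measurable borel" "g \<in> borel_measurable borel" and \<eta>: "0 < \<eta>"
  shows "L2_sq (\<lambda>x. f x + g x) \<le> ennreal (1 + \<eta>) * L2_sq f + ennreal (1 + 1 / \<eta>) * L2_sq g"
proof -
  have pt: "(cmod (a + b))\<^sup>2 \<le> (1 + \<eta>) * (cmod a)\<^sup>2 + (1 + 1 / \<eta>) * (cmod b)\<^sup>2" for a b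
  proof -
    have "0 \<le> (\<eta> * cmod a - cmod b)\<^sup>2 / \<eta>"
      using \<eta> by simp
    also have "\<dots> = \<eta> * (cmod a)\<^sup>2 + (cmod b)\<^sup>2 / \<eta> - 2 * cmod a * cmod b"
      using \<eta> by (simp add: field_simps power2_eq_square)
    finally have "(cmod a + cmod b)\<^sup>2 \<le> (1 + \<eta>) * (cmod a)\<^sup>2 + (1 + 1 / \<eta>) * (cmod b)\<^sup>2"
      by (simp add: power2_eq_square algebra_simps)
    moreover have "(cmod (a + b))\<^sup>2 \<le> (cmod a + cmod b)\<^sup>2"
      by (intro power_mono norm_triangle_ineq) simp
    ultimately show ?thesis by linarith
  qed
  have "L2_sq (\<lambda>x. f x + g x) \<le>
      (\<integral>\<^sup>+x. ennreal (1 + \<eta>) * ennreal ((cmod (f x))\<^sup>2) + ennreal (1 + 1 / \<eta>) * ennreal ((cmod (g x))\<^sup>2) \<partial>lborel)"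
    unfolding L2_sq_def using pt \<eta>
    by (intro nn_integral_mono) (simp add: ennreal_mult'[symmetric] ennreal_plus[symmetric] ennreal_leI del: ennreal_plus)
  also have "\<dots> = ennreal (1 + \<eta>) * L2_sq f + ennreal (1 + 1 / \<eta>) * L2_sq g"
    unfolding L2_sq_def by (simp add: nn_integral_add nn_integral_cmult)
  finally show ?thesis .
qed

lemma L2_sq_diff_le:
  assumes "f \<in> borel_measurable borel" "g \<in> borel_measurable borel"
  shows "L2_sq (\<lambda>x. f x - g x) \<le> 2 * L2_sq f + 2 * L2_sq g"
  using L2_sq_add_le[of f "\<lambda>x. - g x" 1] assms by (simp add: L2_sq_def)

lemma L2_diff:
  assumes "f \<in> L2" "g \<in> L2"
  shows "(\<lambda>x. f x - g x) \<in> L2"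
proof -
  have "L2_sq (\<lambda>x. f x - g x) \<le> 2 * L2_sq f + 2 * L2_sq g"
    using assms by (intro L2_sq_diff_le) (auto simp: L2_def)
  also have "\<dots> < \<infinity>"
    using assms by (auto simp: L2_def ennreal_mult_less_top)
  finally show ?thesis
    using assms by (auto simp: L2_def)
qed

lemma AE_eq_of_L2_sq_diff_eq_0:
  assumes [measurable]: "f \<in> borel_measurable borel" "g \<in> borel_measurable borel"
    and "L2_sq (\<lambda>x. f x - g x) = 0"
  shows "AE x in lborel. f x = g x"
proof -
  have "AE x in lborel. ennreal ((cmod (f x - g x))\<^sup>2) = 0"
    using assms(3) unfolding L2_sq_def by (subst nn_integral_0_iff_AE[symmetric]) simp_all
  then show ?thesis by eventually_elim simp
qed

lemma L2_tendsto_diff: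
  assumes [measurable]: "\<And>n. a n \<in> borel_measurable borel" "\<And>n. b n \<in> borel_measurable borel"
      "f \<in> borel_measurable borel" "g \<in> borel_measurable borel"
    and a: "(\<lambda>n. L2_sq (\<lambda>x. a n x - f x)) \<longlonglongrightarrow> 0" and b: "(\<lambda>n. L2_sq (\<lambda>x. b n x - g x)) \<longlonglongrightarrow> 0"
  shows "(\<lambda>n. L2_sq (\<lambda>x. (a n x - b n x) - (f x - g x))) \<longlonglongrightarrow> 0"
proof (rule tendsto_sandwich[OF _ _ tendsto_const])
  show "(\<lambda>n. 2 * L2_sq (\<lambda>x. a n x - f x) + 2 * L2_sq (\<lambda>x. b n x - g x)) \<longlonglongrightarrow> 0"
    using tendsto_add[OF ennreal_tendsto_cmult[OF _ a, of 2] ennreal_tendsto_cmult[OF _ b, of 2]] by simp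
  show "\<forall>\<^sub>F n in sequentially. L2_sq (\<lambda>x. (a n x - b n x) - (f x - g x)) \<le>
      2 * L2_sq (\<lambda>x. a n x - f x) + 2 * L2_sq (\<lambda>x. b n x - g x)"
  proof (intro always_eventually allI)
    fix n
    have "(\<lambda>x. (a n x - b n x) - (f x - g x)) = (\<lambda>x. (a n x - f x) - (b n x - g x))"
      by (simp add: algebra_simps)
    then show "L2_sq (\<lambda>x. (a n x - b n x) - (f x - g x)) \<le>
        2 * L2_sq (\<lambda>x. a n x - f x) + 2 * L2_sq (\<lambda>x. b n x - g x)"
      using L2_sq_diff_le[of "\<lambda>x. a n x - f x" "\<lambda>x. b n x - g x"] by simp
  qed
qed simp

text \<open>Inequalities between norms pass to \<open>L\<^sup>2\<close> limits: compare each limit with its approximants at a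
  relative loss \<open>1 + \<eta>\<close>, let the index tend to infinity, and then \<open>\<eta>\<close> to zero.\<close>

lemma L2_sq_limit_le:
  assumes [measurable]: "\<And>n. a n \<in> borel_measurable borel" "\<And>n. b n \<in> borel_measurable borel"
      "f \<in> borel_measurable borel" "g \<in> borel_measurable borel"
    and a: "(\<lambda>n. L2_sq (\<lambda>x. a n x - f x)) \<longlonglongrightarrow> 0" and b: "(\<lambda>n. L2_sq (\<lambda>x. b n x - g x)) \<longlonglongrightarrow> 0"
    and le: "\<And>n. L2_sq (b n) \<le> L2_sq (a n)" and fin: "L2_sq f < \<infinity>"
  shows "L2_sq g \<le> L2_sq f"
proof -
  have *: "L2_sq g \<le> ennreal (1 + \<eta>) * (ennreal (1 + \<eta>) * L2_sq f)" if \<eta>: "0 < \<eta>" for \<eta> :: real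
  proof -
    let ?c = "ennreal (1 + \<eta>)" and ?d = "ennreal (1 + 1 / \<eta>)"
    have "L2_sq g \<le> ?c * (?c * L2_sq f + ?d * L2_sq (\<lambda>x. a n x - f x)) + ?d * L2_sq (\<lambda>x. b n x - g x)" for n
    proof -
      have "L2_sq g \<le> ?c * L2_sq (b n) + ?d * L2_sq (\<lambda>x. b n x - g x)"
        using L2_sq_add_le[OF _ _ \<eta>, of "b n" "\<lambda>x. g x - b n x"] by (simp add: L2_sq_diff_commute[of g])
      also have "L2_sq (b n) \<le> L2_sq (a n)" by (rule le)
      also have "L2_sq (a n) \<le> ?c * L2_sq f + ?d * L2_sq (\<lambda>x. a n x - f x)"
        using L2_sq_add_le[OF _ _ \<eta>, of f "\<lambda>x. a n x - f x"] by simp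
      finally show ?thesis by (simp add: mult_left_mono add_right_mono)
    qed
    moreover have "(\<lambda>n. ?c * (?c * L2_sq f + ?d * L2_sq (\<lambda>x. a n x - f x)) + ?d * L2_sq (\<lambda>x. b n x - g x))
        \<longlonglongrightarrow> ?c * (?c * L2_sq f + ?d * 0) + ?d * 0"
      by (intro tendsto_add ennreal_tendsto_cmult tendsto_const a b) simp_all
    ultimately have "L2_sq g \<le> ?c * (?c * L2_sq f + ?d * 0) + ?d * 0"
      by (intro LIMSEQ_le_const) auto
    then show ?thesis by simp
  qed
  obtain r where r: "L2_sq f = ennreal r" "0 \<le> r"
    using fin by (cases "L2_sq f") auto
  have "(\<lambda>n. (1 + inverse (real (Suc n))) * ((1 + inverse (real (Suc n))) * r)) \<longlonglongrightarrow> (1 + 0) * ((1 + 0) * r)"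
    by (intro tendsto_intros LIMSEQ_inverse_real_of_nat)
  then have "(\<lambda>n. ennreal ((1 + inverse (real (Suc n))) * ((1 + inverse (real (Suc n))) * r))) \<longlonglongrightarrow> ennreal r"
    by (intro tendsto_ennrealI) simp
  moreover have "L2_sq g \<le> ennreal ((1 + inverse (real (Suc n))) * ((1 + inverse (real (Suc n))) * r))" for n
    using *[of "inverse (real (Suc n))"] r(2)
    by (simp add: r(1) ennreal_mult'[symmetric] del: of_nat_Suc ennreal_plus)
  ultimately show ?thesis
    unfolding r(1) by (intro LIMSEQ_le_const) auto
qed

text \<open>The argument of Riesz and Fischer. With increments \<open>d\<^sub>n\<close> of squared norm at most \<open>4\<^sup>-\<^sup>n\<close>, the series
  \<open>\<Sum> 2\<^sup>n d\<^sub>n\<^sup>2\<close> has a finite integral and so converges almost everywhere; as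
  \<open>d\<^sub>n \<le> 2\<^sup>n d\<^sub>n\<^sup>2 + 2\<^sup>-\<^sup>n\<close>, so does \<open>\<Sum> d\<^sub>n\<close>. Fatou's lemma turns the pointwise limit into a limit in
  \<open>L\<^sup>2\<close>.\<close>

lemma L2_rapidly_Cauchy_limit:
  assumes [measurable]: "\<And>n. G n \<in> borel_measurable borel"
    and cauchy: "\<And>n m. n \<le> m \<Longrightarrow> L2_sq (\<lambda>x. G n x - G m x) \<le> ennreal ((1 / 4) ^ n)"
  shows "\<exists>g\<in>borel_measurable borel. \<forall>n. L2_sq (\<lambda>x. G n x - g x) \<le> ennreal ((1 / 4) ^ n)"
proof -
  define d where "d n x = cmod (G n x - G (Suc n) x)" for n x
  have [measurable]: "d n \<in> borel_measurable borel" for n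
    unfolding d_def by measurable
  have "(\<integral>\<^sup>+x. (\<Sum>n. ennreal (2 ^ n * (d n x)\<^sup>2)) \<partial>lborel) = (\<Sum>n. \<integral>\<^sup>+x. ennreal (2 ^ n * (d n x)\<^sup>2) \<partial>lborel)"
    by (rule nn_integral_suminf) measurable
  also have "\<dots> = (\<Sum>n. ennreal (2 ^ n) * L2_sq (\<lambda>x. G n x - G (Suc n) x))"
    unfolding L2_sq_def d_def by (simp add: ennreal_mult' nn_integral_cmult)
  also have "\<dots> \<le> (\<Sum>n. ennreal ((1 / 2) ^ n))"
  proof (intro suminf_le allI)
    fix n
    have "ennreal (2 ^ n) * L2_sq (\<lambda>x. G n x - G (Suc n) x) \<le> ennreal (2 ^ n) * ennreal ((1 / 4) ^ n)"
      by (intro mult_left_mono cauchy) simp_all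
    also have "\<dots> = ennreal ((1 / 2) ^ n)"
      by (simp add: ennreal_mult'[symmetric] power_mult_distrib[symmetric])
    finally show "ennreal (2 ^ n) * L2_sq (\<lambda>x. G n x - G (Suc n) x) \<le> ennreal ((1 / 2) ^ n)" .
  qed simp_all
  also have "\<dots> = ennreal (\<Sum>n. (1 / 2) ^ n)"
    by (rule suminf_ennreal2) (simp_all add: summable_geometric)
  also have "\<dots> < \<infinity>" by simp
  finally have "AE x in lborel. (\<Sum>n. ennreal (2 ^ n * (d n x)\<^sup>2)) \<noteq> \<infinity>"
    by (intro nn_integral_noteq_infinite) auto
  then have conv: "AE x in lborel. (\<lambda>n. G n x) \<longlonglongrightarrow> lim (\<lambda>n. G n x)"
  proof eventually_elim
    fix x assume "(\<Sum>n. ennreal (2 ^ n * (d n x)\<^sup>2)) \<noteq> \<infinity>"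
    then have "summable (\<lambda>n. 2 ^ n * (d n x)\<^sup>2)"
      by (intro summable_suminf_not_top) auto
    then have "summable (\<lambda>n. 2 ^ n * (d n x)\<^sup>2 + (1 / 2) ^ n)"
      by (intro summable_add) (auto intro: summable_geometric)
    moreover have "norm (G (Suc n) x - G n x) \<le> 2 ^ n * (d n x)\<^sup>2 + (1 / 2) ^ n" for n
    proof -
      have "0 \<le> (2 ^ n * d n x - 1)\<^sup>2 / 2 ^ n" by simp
      also have "\<dots> = 2 ^ n * (d n x)\<^sup>2 + (1 / 2) ^ n - 2 * d n x"
        by (simp add: field_simps power2_eq_square power_one_over)
      finally have "2 * d n x \<le> 2 ^ n * (d n x)\<^sup>2 + (1 / 2) ^ n" by simp
      moreover have "0 \<le> d n x" by (simp add: d_def)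
      ultimately show ?thesis
        unfolding d_def norm_minus_commute[of "G (Suc n) x"] by linarith
    qed
    ultimately have "summable (\<lambda>n. G (Suc n) x - G n x)"
      by (rule summable_comparison_test'[where N = 0])
    then have "(\<lambda>n. G 0 x + (\<Sum>i<n. G (Suc i) x - G i x)) \<longlonglongrightarrow> G 0 x + (\<Sum>n. G (Suc n) x - G n x)"
      by (intro tendsto_add tendsto_const summable_LIMSEQ)
    then have "convergent (\<lambda>n. G n x)"
      using sum_lessThan_telescope[of "\<lambda>n. G n x"] by (auto simp: convergent_def)
    then show "(\<lambda>n. G n x) \<longlonglongrightarrow> lim (\<lambda>n. G n x)"
      by (simp add: convergent_LIMSEQ_iff)
  qed
  \<comment> \<open>off the set of convergence \<^const>\<open>lim\<close> takes an arbitrary value, but \<open>g\<close> is measurable\<close>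
  define g where "g x = lim (\<lambda>n. G n x)" for x
  have [measurable]: "g \<in> borel_measurable borel"
    unfolding g_def by measurable
  have "L2_sq (\<lambda>x. G n x - g x) \<le> ennreal ((1 / 4) ^ n)" for n
  proof -
    have "L2_sq (\<lambda>x. G n x - g x) = (\<integral>\<^sup>+x. liminf (\<lambda>m. ennreal ((cmod (G n x - G m x))\<^sup>2)) \<partial>lborel)"
      unfolding L2_sq_def
    proof (rule nn_integral_cong_AE, use conv in eventually_elim)
      fix x assume "(\<lambda>n. G n x) \<longlonglongrightarrow> lim (\<lambda>n. G n x)"
      then have "(\<lambda>m. ennreal ((cmod (G n x - G m x))\<^sup>2)) \<longlonglongrightarrow> ennreal ((cmod (G n x - g x))\<^sup>2)"
        unfolding g_def by (intro tendsto_intros)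
      then show "ennreal ((cmod (G n x - g x))\<^sup>2) = liminf (\<lambda>m. ennreal ((cmod (G n x - G m x))\<^sup>2))"
        by (rule lim_imp_Liminf[OF sequentially_bot, symmetric])
    qed
    also have "\<dots> \<le> liminf (\<lambda>m. L2_sq (\<lambda>x. G n x - G m x))"
      unfolding L2_sq_def by (rule nn_integral_liminf) measurable
    also have "\<dots> \<le> liminf (\<lambda>m::nat. ennreal ((1 / 4) ^ n))"
      by (intro Liminf_mono eventually_sequentiallyI[of n] cauchy)
    finally show ?thesis by (simp add: Liminf_const)
  qed
  then show ?thesis by (intro bexI[of _ g]) auto
qed

section \<open>The Fourier transform on \<open>L\<^sup>2\<close>\<close>

lemma is_L2_fourier_fourier_integral:
  assumes f: "integrable lborel f" "f \<in> L2"
  shows "is_L2_fourier f (fourier_integral f)"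
proof -
  have [measurable]: "f \<in> borel_measurable borel" using f by (simp add: L2_def)
  have "L2_sq (fourier_integral f) < \<infinity>"
    using fourier_integral_L2_contraction[OF f(1)] f(2) by (auto simp: L2_def intro: le_less_trans)
  then have "fourier_integral f \<in> L2" by (simp add: L2_def)
  then show ?thesis
    using f unfolding is_L2_fourier_def by (auto intro!: exI[of _ "\<lambda>_. f"] simp: L2_sq_def)
qed

lemma is_L2_fourier_diff:
  assumes "is_L2_fourier f g" "is_L2_fourier f' g'"
  shows "is_L2_fourier (\<lambda>x. f x - f' x) (\<lambda>t. g t - g' t)"
proof -
  obtain h where h: "\<And>n::nat. integrable lborel (h n)" "\<And>n. h n \<in> L2"
    "(\<lambda>n. L2_sq (\<lambda>x. h n x - f x)) \<longlonglongrightarrow> 0"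
    "(\<lambda>n. L2_sq (\<lambda>t. fourier_integral (h n) t - g t)) \<longlonglongrightarrow> 0"
    and fg: "f \<in> L2" "g \<in> L2"
    using assms(1) by (auto simp: is_L2_fourier_def)
  obtain h' where h': "\<And>n::nat. integrable lborel (h' n)" "\<And>n. h' n \<in> L2"
    "(\<lambda>n. L2_sq (\<lambda>x. h' n x - f' x)) \<longlonglongrightarrow> 0"
    "(\<lambda>n. L2_sq (\<lambda>t. fourier_integral (h' n) t - g' t)) \<longlonglongrightarrow> 0"
    and fg': "f' \<in> L2" "g' \<in> L2"
    using assms(2) by (auto simp: is_L2_fourier_def)
  note [measurable] = h(2)[THEN borel_measurable_L2] h'(2)[THEN borel_measurable_L2]
    fg[THEN borel_measurable_L2] fg'[THEN borel_measurable_L2]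
  have "(\<lambda>n. L2_sq (\<lambda>x. (h n x - h' n x) - (f x - f' x))) \<longlonglongrightarrow> 0"
    by (rule L2_tendsto_diff[OF _ _ _ _ h(3) h'(3)]) measurable
  moreover have "(\<lambda>n. L2_sq (\<lambda>t. fourier_integral (\<lambda>x. h n x - h' n x) t - (g t - g' t))) \<longlonglongrightarrow> 0"
    unfolding fourier_integral_diff[OF h(1) h'(1)]
    by (rule L2_tendsto_diff[OF _ _ _ _ h(4) h'(4)]) measurable
  ultimately show ?thesis
    unfolding is_L2_fourier_def using h h' fg fg'
    by (auto intro!: L2_diff exI[of _ "\<lambda>n x. h n x - h' n x"] Bochner_Integration.integrable_diff)
qed

lemma is_L2_fourier_contraction:
  assumes "is_L2_fourier f g"
  shows "L2_sq g \<le> L2_sq f"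
proof -
  obtain h where h: "\<And>n::nat. integrable lborel (h n)" "\<And>n. h n \<in> L2"
    "(\<lambda>n. L2_sq (\<lambda>x. h n x - f x)) \<longlonglongrightarrow> 0"
    "(\<lambda>n. L2_sq (\<lambda>t. fourier_integral (h n) t - g t)) \<longlonglongrightarrow> 0"
    and fg: "f \<in> L2" "g \<in> L2"
    using assms by (auto simp: is_L2_fourier_def)
  note [measurable] = h(2)[THEN borel_measurable_L2] fg[THEN borel_measurable_L2]
  show ?thesis
    by (rule L2_sq_limit_le[OF _ _ _ _ h(3) h(4)])
      (use fg fourier_integral_L2_contraction[OF h(1)] in \<open>auto simp: L2_def\<close>)
qed

text \<open>The difference of two transforms of \<open>f\<close> is a transform of zero, so it vanishes by contraction.\<close>

lemma is_L2_fourier_unique: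
  assumes "is_L2_fourier f g" "is_L2_fourier f g'"
  shows "AE t in lborel. g t = g' t"
proof (rule AE_eq_of_L2_sq_diff_eq_0)
  show "L2_sq (\<lambda>t. g t - g' t) = 0"
    using is_L2_fourier_contraction[OF is_L2_fourier_diff[OF assms]] by (simp add: L2_sq_def)
qed (use assms in \<open>auto simp: is_L2_fourier_def L2_def\<close>)

text \<open>Truncation to a bounded interval: there \<open>|f| \<le> |f|\<^sup>2 + 1\<close> is integrable.\<close>

lemma L2_approx_integrable:
  fixes \<epsilon> :: ennreal
  assumes f: "f \<in> L2" and \<epsilon>: "0 < \<epsilon>"
  shows "\<exists>h. integrable lborel h \<and> h \<in> L2 \<and> L2_sq (\<lambda>x. h x - f x) < \<epsilon>"
proof -
  note [measurable] = f[THEN borel_measurable_L2]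
  define h where "h n x = f x * indicator {- real n..real n} x" for n x
  have [measurable]: "h n \<in> borel_measurable borel" for n
    unfolding h_def by measurable
  have fin: "(\<integral>\<^sup>+x. ennreal ((cmod (f x))\<^sup>2) \<partial>lborel) < \<infinity>"
    using f by (simp add: L2_def L2_sq_def)
  have "(\<lambda>n. \<integral>\<^sup>+x. ennreal ((cmod (h n x - f x))\<^sup>2) \<partial>lborel) \<longlonglongrightarrow> (\<integral>\<^sup>+x. 0 \<partial>(lborel :: real measure))"
  proof (rule nn_integral_dominated_convergence[where w = "\<lambda>x. ennreal ((cmod (f x))\<^sup>2)"])
    show "AE x in lborel. (\<lambda>n. ennreal ((cmod (h n x - f x))\<^sup>2)) \<longlonglongrightarrow> 0"
    proof (intro AE_I2 tendsto_eventually)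
      fix x
      obtain N where N: "\<bar>x\<bar> \<le> real N" using real_arch_simple by blast
      show "\<forall>\<^sub>F n in sequentially. ennreal ((cmod (h n x - f x))\<^sup>2) = 0"
        using N by (intro eventually_sequentiallyI[of N]) (auto simp: h_def indicator_def)
    qed
  qed (use fin in \<open>auto simp: h_def indicator_def\<close>)
  then have "(\<lambda>n. L2_sq (\<lambda>x. h n x - f x)) \<longlonglongrightarrow> 0"
    by (simp add: L2_sq_def)
  then have "\<forall>\<^sub>F n in sequentially. L2_sq (\<lambda>x. h n x - f x) < \<epsilon>"
    using \<epsilon> by (intro order_tendstoD(2)) simp_all
  then obtain n where n: "L2_sq (\<lambda>x. h n x - f x) < \<epsilon>"
    by (auto simp: eventually_sequentially)
  have "L2_sq (h n) \<le> L2_sq f"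
    unfolding L2_sq_def by (intro nn_integral_mono) (auto simp: h_def indicator_def)
  then have L: "h n \<in> L2"
    using f by (auto simp: L2_def)
  have "(\<integral>\<^sup>+x. ennreal (cmod (h n x)) \<partial>lborel) \<le>
      (\<integral>\<^sup>+x. ennreal ((cmod (f x))\<^sup>2) + indicator {- real n..real n} x \<partial>lborel)"
  proof (rule nn_integral_mono)
    fix x
    have "0 \<le> (cmod (f x) - 1)\<^sup>2" by simp
    then have "2 * cmod (f x) \<le> (cmod (f x))\<^sup>2 + 1" by (simp add: power2_diff)
    then have "cmod (f x) \<le> (cmod (f x))\<^sup>2 + 1" using norm_ge_zero[of "f x"] by linarith
    then have "ennreal (cmod (f x)) \<le> ennreal ((cmod (f x))\<^sup>2) + 1"
      by (simp add: ennreal_1[symmetric] ennreal_plus[symmetric] ennreal_leI del: ennreal_1 ennreal_plus)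
    then show "ennreal (cmod (h n x)) \<le> ennreal ((cmod (f x))\<^sup>2) + indicator {- real n..real n} x"
      by (auto simp: h_def indicator_def)
  qed
  also have "\<dots> = (\<integral>\<^sup>+x. ennreal ((cmod (f x))\<^sup>2) \<partial>lborel) + emeasure lborel {- real n..real n}"
    by (simp add: nn_integral_add)
  also have "\<dots> < \<infinity>" using fin by simp
  finally have "integrable lborel (h n)"
    by (intro integrableI_bounded) auto
  with L n show ?thesis by blast
qed

text \<open>Integrable functions that approach \<open>f\<close> fast enough have, by contraction, transforms that form a
  rapidly Cauchy sequence.\<close>

lemma is_L2_fourier_exists:
  assumes f: "f \<in> L2"
  shows "\<exists>g. is_L2_fourier f g"
proof -
  \<comment> \<open>the extra factor \<open>1 / 4\<close> absorbs two errors, each with the factor \<open>2\<close> of the triangle inequality\<close>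
  have "\<exists>h. integrable lborel h \<and> h \<in> L2 \<and> L2_sq (\<lambda>x. h x - f x) < ennreal ((1 / 4) ^ n / 4)" for n :: nat
    by (rule L2_approx_integrable[OF f]) (simp add: ennreal_zero_less_divide)
  then obtain h where h: "\<And>n::nat. integrable lborel (h n)" "\<And>n. h n \<in> L2"
      "\<And>n. L2_sq (\<lambda>x. h n x - f x) < ennreal ((1 / 4) ^ n / 4)"
    by metis
  note [measurable] = h(2)[THEN borel_measurable_L2] f[THEN borel_measurable_L2]
  have "L2_sq (\<lambda>t. fourier_integral (h n) t - fourier_integral (h m) t) \<le> ennreal ((1 / 4) ^ n)"
    if "n \<le> m" for n m
  proof -
    have "L2_sq (\<lambda>t. fourier_integral (h n) t - fourier_integral (h m) t) \<le> L2_sq (\<lambda>x. h n x - h m x)"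
      unfolding fourier_integral_diff[OF h(1) h(1), symmetric]
      by (intro fourier_integral_L2_contraction Bochner_Integration.integrable_diff h(1))
    also have "\<dots> \<le> 2 * L2_sq (\<lambda>x. h n x - f x) + 2 * L2_sq (\<lambda>x. h m x - f x)"
      using L2_sq_diff_le[of "\<lambda>x. h n x - f x" "\<lambda>x. h m x - f x"] by simp
    also have "\<dots> \<le> 2 * ennreal ((1 / 4) ^ n / 4) + 2 * ennreal ((1 / 4) ^ m / 4)"
      by (intro add_mono mult_left_mono less_imp_le h(3)) simp_all
    also have "\<dots> = ennreal (2 * ((1 / 4) ^ n / 4) + 2 * ((1 / 4) ^ m / 4))"
    proof -
      have "2 * ennreal a = ennreal (2 * a)" for a
        by (simp add: ennreal_mult')
      then show ?thesis by simp
    qed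
    also have "\<dots> \<le> ennreal ((1 / 4) ^ n)"
    proof (rule ennreal_leI)
      have "(1 / 4 :: real) ^ m \<le> (1 / 4) ^ n"
        using that by (rule power_decreasing) simp_all
      then show "2 * ((1 / 4 :: real) ^ n / 4) + 2 * ((1 / 4) ^ m / 4) \<le> (1 / 4) ^ n"
        by linarith
    qed
    finally show ?thesis .
  qed
  from L2_rapidly_Cauchy_limit[OF _ this] obtain g where [measurable]: "g \<in> borel_measurable borel"
    and g: "\<And>n. L2_sq (\<lambda>t. fourier_integral (h n) t - g t) \<le> ennreal ((1 / 4) ^ n)"
    by auto
  have small: "(\<lambda>n. ennreal ((1 / 4) ^ n)) \<longlonglongrightarrow> 0"
    by (subst ennreal_0[symmetric]) (intro tendsto_ennrealI LIMSEQ_power_zero, simp)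
  have hf: "(\<lambda>n. L2_sq (\<lambda>x. h n x - f x)) \<longlonglongrightarrow> 0"
  proof (rule tendsto_sandwich[OF _ _ tendsto_const small])
    have "L2_sq (\<lambda>x. h n x - f x) \<le> ennreal ((1 / 4) ^ n)" for n
      using less_imp_le[OF h(3)[of n]] by (rule order_trans) (intro ennreal_leI, simp)
    then show "\<forall>\<^sub>F n in sequentially. L2_sq (\<lambda>x. h n x - f x) \<le> ennreal ((1 / 4) ^ n)" by simp
  qed simp
  have Fg: "(\<lambda>n. L2_sq (\<lambda>t. fourier_integral (h n) t - g t)) \<longlonglongrightarrow> 0"
    by (rule tendsto_sandwich[OF _ _ tendsto_const small]) (use g in simp_all)
  have "L2_sq g \<le> L2_sq f"
    by (rule L2_sq_limit_le[OF _ _ _ _ hf Fg])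
      (use f fourier_integral_L2_contraction[OF h(1)] in \<open>auto simp: L2_def\<close>)
  then have "g \<in> L2" using f by (auto simp: L2_def)
  then have "is_L2_fourier f g"
    unfolding is_L2_fourier_def using f h(1,2) hf Fg by blast
  then show ?thesis by blast
qed

lemma is_L2_fourier_fourier:
  assumes "f \<in> L2"
  shows "is_L2_fourier f (fourier f)"
  using is_L2_fourier_fourier_integral[OF _ assms] someI_ex[OF is_L2_fourier_exists[OF assms]]
  by (auto simp: fourier_def)

lemma AE_fourier_diff:
  assumes "f \<in> L2" "g \<in> L2"
  shows "AE t in lborel. fourier (\<lambda>x. f x - g x) t = fourier f t - fourier g t"
  using assms by (intro is_L2_fourier_unique[OF is_L2_fourier_fourier is_L2_fourier_diff] L2_diff is_L2_fourier_fourier)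

lemma fourier_contraction:
  assumes "f \<in> L2" "g \<in> L2"
  shows "L2_sq (\<lambda>t. fourier f t - fourier g t) \<le> L2_sq (\<lambda>x. f x - g x)"
  using assms by (intro is_L2_fourier_contraction is_L2_fourier_diff is_L2_fourier_fourier)

lemma borel_measurable_fourier:
  "f \<in> L2 \<Longrightarrow> fourier f \<in> borel_measurable borel"
  using is_L2_fourier_fourier[of f] by (simp add: is_L2_fourier_def L2_def)

section \<open>The convolution theorem and the law of the sample\<close>

lemma conv_complex:
  "complex_of_real (conv f g y) = (\<integral>x. complex_of_real (f (y - x)) * complex_of_real (g x) \<partial>lborel)"
  unfolding conv_def by (subst integral_complex_of_real[symmetric]) simp

text \<open>The iterated integral is the product of the two \<open>L\<^sup>1\<close> norms.\<close>

lemma nn_integral_conv_kernel_finite: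
  fixes f g :: "real \<Rightarrow> real"
  assumes f: "integrable lborel f" and g: "integrable lborel g"
  shows "(\<integral>\<^sup>+x. \<integral>\<^sup>+y. ennreal \<bar>f (y - x) * g x\<bar> \<partial>lborel \<partial>lborel) < \<infinity>"
proof -
  have [measurable]: "f \<in> borel_measurable borel" "g \<in> borel_measurable borel"
    using f g by (auto dest: borel_measurable_integrable)
  have shift: "(\<integral>\<^sup>+y. ennreal \<bar>f (y - x)\<bar> \<partial>lborel) = (\<integral>\<^sup>+y. ennreal \<bar>f y\<bar> \<partial>lborel)" for x
    using nn_integral_real_affine[of "\<lambda>x. ennreal \<bar>f x\<bar>" 1 "-x"] by simp
  have "(\<integral>\<^sup>+x. \<integral>\<^sup>+y. ennreal \<bar>f (y - x) * g x\<bar> \<partial>lborel \<partial>lborel) =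
      (\<integral>\<^sup>+y. ennreal \<bar>f y\<bar> \<partial>lborel) * (\<integral>\<^sup>+x. ennreal \<bar>g x\<bar> \<partial>lborel)"
    by (simp add: abs_mult ennreal_mult' nn_integral_multc nn_integral_cmult shift)
  also have "\<dots> < \<infinity>"
    using f g by (simp add: integrable_iff_bounded ennreal_mult_less_top)
  finally show ?thesis .
qed

lemma integrable_conv:
  assumes f: "integrable lborel f" and g: "integrable lborel g"
  shows "integrable lborel (conv f g)"
proof -
  have [measurable]: "f \<in> borel_measurable borel" "g \<in> borel_measurable borel"
    using f g by (auto dest: borel_measurable_integrable)
  have "(\<integral>\<^sup>+p. ennreal (norm (case p of (x, y) \<Rightarrow> f (y - x) * g x)) \<partial>(lborel \<Otimes>\<^sub>M lborel)) < \<infinity>"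
    using nn_integral_conv_kernel_finite[OF f g] by (subst lborel.nn_integral_fst[symmetric]) simp_all
  then have "integrable (lborel \<Otimes>\<^sub>M lborel) (\<lambda>(x, y). f (y - x) * g x)"
    by (intro integrableI_bounded) auto
  from lborel_pair.integrable_snd[OF this] show ?thesis
    unfolding conv_def by simp
qed

lemma fourier_integral_conv:
  assumes f: "integrable lborel f" and g: "integrable lborel g"
  shows "fourier_integral (\<lambda>y. complex_of_real (conv f g y)) t =
    complex_of_real (sqrt (2 * pi)) * fourier_integral (\<lambda>x. complex_of_real (f x)) t *
      fourier_integral (\<lambda>x. complex_of_real (g x)) t"
proof -
  have [measurable]: "f \<in> borel_measurable borel" "g \<in> borel_measurable borel"
    using f g by (auto dest: borel_measurable_integrable)
  let ?e = "\<lambda>x. exp (- (\<i> * complex_of_real t * complex_of_real x))"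
  define k where "k x y = ?e y * (complex_of_real (f (y - x)) * complex_of_real (g x))" for x y
  have swap: "(\<integral>x. \<integral>y. k x y \<partial>lborel \<partial>lborel) = (\<integral>y. \<integral>x. k x y \<partial>lborel \<partial>lborel)"
  proof (rule lborel_integral_swap)
    show "(\<integral>\<^sup>+x. \<integral>\<^sup>+y. ennreal (cmod (k x y)) \<partial>lborel \<partial>lborel) < \<infinity>"
      using nn_integral_conv_kernel_finite[OF f g] by (simp add: k_def norm_mult abs_mult)
  qed (simp add: k_def case_prod_beta)
  have inner: "(\<integral>y. k x y \<partial>lborel) = (\<integral>u. ?e u * complex_of_real (f u) \<partial>lborel) * (?e x * complex_of_real (g x))" for x
  proof -
    have "(\<integral>y. k x y \<partial>lborel) = (\<integral>u. k x (x + u) \<partial>lborel)"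
      by (subst lborel_integral_real_affine[of 1 _ x]) simp_all
    also have "\<dots> = (\<integral>u. (?e u * complex_of_real (f u)) * (?e x * complex_of_real (g x)) \<partial>lborel)"
    proof (intro Bochner_Integration.integral_cong refl)
      fix u
      have "?e (x + u) = ?e u * ?e x"
        by (simp add: exp_add[symmetric] algebra_simps)
      then show "k x (x + u) = (?e u * complex_of_real (f u)) * (?e x * complex_of_real (g x))"
        unfolding k_def by (simp only: mult_ac) simp
    qed
    also have "\<dots> = (\<integral>u. ?e u * complex_of_real (f u) \<partial>lborel) * (?e x * complex_of_real (g x))"
      by (rule integral_mult_left_zero)
    finally show ?thesis .
  qed
  have "(\<integral>y. ?e y * complex_of_real (conv f g y) \<partial>lborel) = (\<integral>y. \<integral>x. k x y \<partial>lborel \<partial>lborel)"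
    unfolding conv_complex k_def by simp
  also have "\<dots> = (\<integral>u. ?e u * complex_of_real (f u) \<partial>lborel) * (\<integral>x. ?e x * complex_of_real (g x) \<partial>lborel)"
    unfolding swap[symmetric] inner by (rule integral_mult_right_zero)
  finally have *: "(\<integral>y. ?e y * complex_of_real (conv f g y) \<partial>lborel) = \<dots>" .
  have "complex_of_real (1 / sqrt (2 * pi)) = complex_of_real (sqrt (2 * pi)) *
      complex_of_real (1 / sqrt (2 * pi)) * complex_of_real (1 / sqrt (2 * pi))"
    by (simp only: of_real_mult[symmetric]) simp
  then have r: "complex_of_real (1 / sqrt (2 * pi)) * (a * b) = complex_of_real (sqrt (2 * pi)) *
      (complex_of_real (1 / sqrt (2 * pi)) * a) * (complex_of_real (1 / sqrt (2 * pi)) * b)" for a b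
    by (metis mult.assoc mult.left_commute)
  show ?thesis
    unfolding fourier_integral_def * r ..
qed

lemma L2_density_integrable:
  assumes "f \<in> L2_densities"
  shows "integrable lborel f" and "(\<integral>x. f x \<partial>lborel) = 1"
proof -
  have [measurable]: "f \<in> borel_measurable borel" and nn: "AE x in lborel. 0 \<le> f x"
    and int: "(\<integral>\<^sup>+x. ennreal (f x) \<partial>lborel) = ennreal 1"
    using assms by (auto simp: L2_densities_def)
  from nn_integral_eq_integrable[of f lborel 1] nn int
  show "integrable lborel f" and "(\<integral>x. f x \<partial>lborel) = 1" by auto
qed

text \<open>The total mass is the convolution theorem at frequency zero.\<close>

lemma nn_integral_conv_L2_densities:
  assumes f: "f \<in> L2_densities" and g: "g \<in> L2_densities"
  shows "(\<integral>\<^sup>+y. ennreal (conv f g y) \<partial>lborel) = 1"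
proof -
  note fi = L2_density_integrable[OF f] and gi = L2_density_integrable[OF g]
  have nn: "AE x in lborel. 0 \<le> f x" "AE x in lborel. 0 \<le> g x" and [measurable]: "f \<in> borel_measurable borel"
    using f g by (auto simp: L2_densities_def)
  have "0 \<le> conv f g y" for y
  proof -
    have "AE x in lborel. 0 \<le> f (y - x)"
      using AE_borel_affine[of "-1" "\<lambda>x. 0 \<le> f x" y] nn(1) by simp
    with nn(2) have "AE x in lborel. 0 \<le> f (y - x) * g x"
      by eventually_elim simp
    then show ?thesis
      unfolding conv_def by (rule integral_nonneg_AE)
  qed
  moreover have "(\<integral>y. conv f g y \<partial>lborel) = 1"
    using fourier_integral_conv[OF fi(1) gi(1), of 0] fi(2) gi(2)
    by (simp add: fourier_integral_def)
  ultimately show ?thesis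
    using integrable_conv[OF fi(1) gi(1)] by (subst nn_integral_eq_integral) simp_all
qed

lemma prob_space_sample_law:
  assumes f: "f \<in> borel_measurable borel" "(\<integral>\<^sup>+x. ennreal (f x) \<partial>lborel) = 1"
  shows "prob_space (sample_law n f)"
  unfolding sample_law_def
proof (intro prob_space_PiM prob_spaceI)
  show "emeasure (density lborel (\<lambda>x. ennreal (f x))) (space (density lborel (\<lambda>x. ennreal (f x)))) = 1"
    using f by (simp add: emeasure_density)
qed

lemma fourier_real_density:
  assumes "f \<in> L2_densities"
  shows "fourier_real f = fourier_integral (\<lambda>x. complex_of_real (f x))"
  using L2_density_integrable(1)[OF assms] by (auto simp: fourier_def)

lemma fourier_real_conv:
  assumes "f \<in> L2_densities" "g \<in> L2_densities"
  shows "fourier_real (conv f g) t = complex_of_real (sqrt (2 * pi)) * fourier_real f t * fourier_real g t"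
  using fourier_integral_conv[OF assms[THEN L2_density_integrable(1)], of t]
    integrable_conv[OF assms[THEN L2_density_integrable(1)]]
  by (simp add: fourier_real_density[OF assms(1)] fourier_real_density[OF assms(2)]) (simp add: fourier_def)

section \<open>The error of the spectral cut-off estimator\<close>

text \<open>Variance: the error in \<open>d\<close> is divided by \<open>\<surd>(2\<pi>) e\<close>, and the Sobolev weight \<open>l\<^sup>2\<close> combines with
  \<open>|e|\<^sup>2\<close> to the quantity that the window bounds from below.\<close>

lemma cutoff_error_on_window:
  fixes e x d :: complex and l \<alpha> :: real
  assumes e: "e \<noteq> 0" and \<alpha>: "0 < \<alpha>" and l: "0 < l" and window: "\<alpha> \<le> (cmod (e / complex_of_real l))\<^sup>2"
  shows "l\<^sup>2 * (cmod (d * cnj e / complex_of_real (sqrt (2 * pi) * (cmod e)\<^sup>2) - x))\<^sup>2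
     \<le> (cmod (d - complex_of_real (sqrt (2 * pi)) * x * e))\<^sup>2 / (2 * pi * \<alpha>)"
proof -
  let ?r = "complex_of_real (sqrt (2 * pi))"
  let ?D = "cmod (d - ?r * x * e)"
  have r: "?r \<noteq> 0" by simp
  have ee: "complex_of_real ((cmod e)\<^sup>2) = e * cnj e"
    by (rule complex_norm_square)
  have "d * cnj e / complex_of_real (sqrt (2 * pi) * (cmod e)\<^sup>2) - x = (d - ?r * x * e) / (?r * e)"
    unfolding of_real_mult ee using e r by (simp add: divide_simps)
  then have "(cmod (d * cnj e / complex_of_real (sqrt (2 * pi) * (cmod e)\<^sup>2) - x))\<^sup>2 = ?D\<^sup>2 / (2 * pi * (cmod e)\<^sup>2)"
    by (simp add: norm_divide norm_mult power_divide power_mult_distrib)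
  then have "l\<^sup>2 * (cmod (d * cnj e / complex_of_real (sqrt (2 * pi) * (cmod e)\<^sup>2) - x))\<^sup>2 =
      ?D\<^sup>2 / (2 * pi * (cmod (e / complex_of_real l))\<^sup>2)"
    using l by (simp add: norm_divide power_divide)
  also have "\<dots> \<le> ?D\<^sup>2 / (2 * pi * \<alpha>)"
    using window \<alpha> by (intro divide_left_mono mult_left_mono mult_pos_pos) auto
  finally show ?thesis .
qed

text \<open>Bias: \<open>|ln|\<close> is decreasing on \<open>(0, 1)\<close>, so the logarithmic factor of the source condition is at
  least \<open>|ln \<alpha>|\<^sup>\<beta>\<close> below the threshold.\<close>

lemma cutoff_error_off_window:
  fixes x :: complex and l p \<alpha> \<beta> :: real
  assumes p: "0 < p" "p < \<alpha>" and \<alpha>: "\<alpha> < 1" and \<beta>: "0 \<le> \<beta>"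
  shows "l\<^sup>2 * (cmod x)\<^sup>2 \<le> \<bar>ln \<alpha>\<bar> powr (- \<beta>) *
     (cmod (complex_of_real l * x * complex_of_real (\<bar>ln p\<bar> powr (\<beta> / 2))))\<^sup>2"
proof -
  have "ln p < ln \<alpha>" "ln \<alpha> < 0" using p \<alpha> by simp_all
  then have ln: "0 < \<bar>ln \<alpha>\<bar>" "\<bar>ln \<alpha>\<bar> \<le> \<bar>ln p\<bar>" by simp_all
  have "1 = \<bar>ln \<alpha>\<bar> powr (- \<beta>) * \<bar>ln \<alpha>\<bar> powr \<beta>"
    using ln by (simp add: powr_add[symmetric])
  also have "\<dots> \<le> \<bar>ln \<alpha>\<bar> powr (- \<beta>) * \<bar>ln p\<bar> powr \<beta>"
    using ln \<beta> by (intro mult_left_mono powr_mono2) auto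
  finally have "l\<^sup>2 * (cmod x)\<^sup>2 * 1 \<le> l\<^sup>2 * (cmod x)\<^sup>2 * (\<bar>ln \<alpha>\<bar> powr (- \<beta>) * \<bar>ln p\<bar> powr \<beta>)"
    by (intro mult_left_mono) simp_all
  moreover have "(\<bar>ln p\<bar> powr (\<beta> / 2))\<^sup>2 = \<bar>ln p\<bar> powr \<beta>"
    by (simp add: power2_eq_square powr_add[symmetric])
  ultimately show ?thesis
    by (simp add: norm_mult power_mult_distrib mult_ac)
qed

text \<open>The deterministic error bound for one realisation \<open>g\<close> of the estimator of \<open>f\<^sub>Y\<close>. If \<open>g\<close> has
  infinite distance from \<open>f\<^sub>Y\<close> there is nothing to show; otherwise \<open>f\<^sub>Y\<close> lies in \<open>L\<^sup>2\<close>, being the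
  difference of two functions in \<open>L\<^sup>2\<close>, and contraction applies to \<open>g - f\<^sub>Y\<close>.\<close>

lemma spectral_cutoff_sobolev_le:
  assumes fX: "fX \<in> L2_densities" and feps: "feps \<in> L2_densities"
    and nz: "\<And>t. fourier_real feps t \<noteq> 0"
    and src: "source_fun s \<beta> feps fX \<in> L2"
    and \<alpha>: "0 < \<alpha>" "\<alpha> < 1" and \<beta>: "0 \<le> \<beta>"
    and g: "g \<in> L2" and cut: "is_spectral_cutoff s \<alpha> feps g h"
  shows "sobolev_sq s (\<lambda>x. h x - complex_of_real (fX x)) \<le>
    ennreal (1 / (2 * pi * \<alpha>)) * L2_sq (\<lambda>x. g x - complex_of_real (conv fX feps x)) +
    ennreal (\<bar>ln \<alpha>\<bar> powr (- \<beta>)) * L2_sq (source_fun s \<beta> feps fX)"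
proof (cases "L2_sq (\<lambda>x. g x - complex_of_real (conv fX feps x)) < \<infinity>")
  case False
  then show ?thesis
    using \<alpha> by (simp add: less_top[symmetric] ennreal_mult_top)
next
  case True
  let ?fY = "\<lambda>x. complex_of_real (conv fX feps x)"
  let ?e = "fourier_real feps" and ?x = "fourier_real fX"
  have [measurable]: "conv fX feps \<in> borel_measurable borel"
    using integrable_conv[OF L2_density_integrable(1)[OF fX] L2_density_integrable(1)[OF feps]]
    by (auto dest: borel_measurable_integrable)
  note [measurable] = g[THEN borel_measurable_L2] src[THEN borel_measurable_L2]
  have "(\<lambda>x. g x - ?fY x) \<in> L2"
    using True by (simp add: L2_def)
  from L2_diff[OF g this] have fY: "?fY \<in> L2" by simp
  have h: "h \<in> L2" and hF: "AE t in lborel. fourier h t =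
      fourier g t * cnj (?e t) / complex_of_real (sqrt (2 * pi) * (cmod (?e t))\<^sup>2) *
      indicator {u. (cmod (?e u / complex_of_real (ell s u)))\<^sup>2 \<ge> \<alpha>} t"
    using cut by (auto simp: is_spectral_cutoff_def)
  have fX2: "(\<lambda>x. complex_of_real (fX x)) \<in> L2"
    using fX by (simp add: L2_densities_def)
  let ?A = "\<lambda>t. (cmod (fourier g t - fourier ?fY t))\<^sup>2"
  let ?B = "\<lambda>t. (cmod (source_fun s \<beta> feps fX t))\<^sup>2"
  have [measurable]: "fourier g \<in> borel_measurable borel" "fourier ?fY \<in> borel_measurable borel"
    using g fY by (auto intro: borel_measurable_fourier)
  have "AE t in lborel. (1 + t\<^sup>2) powr s * (cmod (fourier (\<lambda>x. h x - complex_of_real (fX x)) t))\<^sup>2 \<le>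
      1 / (2 * pi * \<alpha>) * ?A t + \<bar>ln \<alpha>\<bar> powr (- \<beta>) * ?B t"
    using AE_fourier_diff[OF h fX2] hF
  proof eventually_elim
    fix t
    let ?l = "ell s t"
    assume d: "fourier (\<lambda>x. h x - complex_of_real (fX x)) t = fourier h t - ?x t"
      and hF: "fourier h t =
        fourier g t * cnj (?e t) / complex_of_real (sqrt (2 * pi) * (cmod (?e t))\<^sup>2) *
        indicator {u. (cmod (?e u / complex_of_real (ell s u)))\<^sup>2 \<ge> \<alpha>} t"
    have "0 < 1 + t\<^sup>2" by (simp add: add_pos_nonneg)
    then have l: "0 < ?l" "(1 + t\<^sup>2) powr s = ?l\<^sup>2"
      by (simp_all add: ell_def powr_power)
    show "(1 + t\<^sup>2) powr s * (cmod (fourier (\<lambda>x. h x - complex_of_real (fX x)) t))\<^sup>2 \<le>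
        1 / (2 * pi * \<alpha>) * ?A t + \<bar>ln \<alpha>\<bar> powr (- \<beta>) * ?B t"
    proof (cases "\<alpha> \<le> (cmod (?e t / complex_of_real ?l))\<^sup>2")
      case True
      then have "fourier h t = fourier g t * cnj (?e t) / complex_of_real (sqrt (2 * pi) * (cmod (?e t))\<^sup>2)"
        using hF by simp
      then have "(1 + t\<^sup>2) powr s * (cmod (fourier (\<lambda>x. h x - complex_of_real (fX x)) t))\<^sup>2 \<le>
          1 / (2 * pi * \<alpha>) * ?A t"
        using cutoff_error_on_window[OF nz \<alpha>(1) l(1) True, of "fourier g t" "?x t"]
        unfolding d l(2) fourier_real_conv[OF fX feps] by simp
      then show ?thesis
        by (rule order_trans) simp
    next
      case False
      then have "fourier h t = 0"
        using hF by simp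
      moreover have "?l\<^sup>2 * (cmod (?x t))\<^sup>2 \<le> \<bar>ln \<alpha>\<bar> powr (- \<beta>) * ?B t"
        unfolding source_fun_def
        using False nz[of t] l(1) by (intro cutoff_error_off_window \<alpha>(2) \<beta>) auto
      ultimately have "(1 + t\<^sup>2) powr s * (cmod (fourier (\<lambda>x. h x - complex_of_real (fX x)) t))\<^sup>2 \<le>
          \<bar>ln \<alpha>\<bar> powr (- \<beta>) * ?B t"
        unfolding d l(2) by simp
      then show ?thesis
        by (rule order_trans) (use \<alpha> in simp)
    qed
  qed
  then have "AE t in lborel. ennreal ((1 + t\<^sup>2) powr s * (cmod (fourier (\<lambda>x. h x - complex_of_real (fX x)) t))\<^sup>2) \<le>
      ennreal (1 / (2 * pi * \<alpha>)) * ennreal (?A t) + ennreal (\<bar>ln \<alpha>\<bar> powr (- \<beta>)) * ennreal (?B t)"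
  proof eventually_elim
    fix t
    assume "(1 + t\<^sup>2) powr s * (cmod (fourier (\<lambda>x. h x - complex_of_real (fX x)) t))\<^sup>2 \<le>
        1 / (2 * pi * \<alpha>) * ?A t + \<bar>ln \<alpha>\<bar> powr (- \<beta>) * ?B t"
    moreover have "0 \<le> 1 / (2 * pi * \<alpha>)" "0 \<le> \<bar>ln \<alpha>\<bar> powr (- \<beta>)" using \<alpha> by simp_all
    ultimately show "ennreal ((1 + t\<^sup>2) powr s * (cmod (fourier (\<lambda>x. h x - complex_of_real (fX x)) t))\<^sup>2) \<le>
        ennreal (1 / (2 * pi * \<alpha>)) * ennreal (?A t) + ennreal (\<bar>ln \<alpha>\<bar> powr (- \<beta>)) * ennreal (?B t)"
      by (simp add: ennreal_mult'[symmetric] ennreal_plus[symmetric] ennreal_leI del: ennreal_plus)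
  qed
  then have "sobolev_sq s (\<lambda>x. h x - complex_of_real (fX x)) \<le>
      (\<integral>\<^sup>+t. ennreal (1 / (2 * pi * \<alpha>)) * ennreal (?A t) + ennreal (\<bar>ln \<alpha>\<bar> powr (- \<beta>)) * ennreal (?B t) \<partial>lborel)"
    unfolding sobolev_sq_def by (rule nn_integral_mono_AE)
  also have "\<dots> = ennreal (1 / (2 * pi * \<alpha>)) * L2_sq (\<lambda>t. fourier g t - fourier ?fY t) +
      ennreal (\<bar>ln \<alpha>\<bar> powr (- \<beta>)) * L2_sq (source_fun s \<beta> feps fX)"
    unfolding L2_sq_def by (simp add: nn_integral_add nn_integral_cmult)
  also have "\<dots> \<le> ennreal (1 / (2 * pi * \<alpha>)) * L2_sq (\<lambda>x. g x - ?fY x) +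
      ennreal (\<bar>ln \<alpha>\<bar> powr (- \<beta>)) * L2_sq (source_fun s \<beta> feps fX)"
    by (intro add_right_mono mult_left_mono fourier_contraction g fY) simp
  finally show ?thesis .
qed

text \<open>Integration of the previous bound over the law of the sample. The Sobolev error need not
  be measurable in the sample, as the versions of \<open>S y\<close> may be chosen arbitrarily for each \<open>y\<close>; only
  monotonicity of the integral is used for it, and additivity only for the measurable upper
  bound.\<close>

lemma sobolev_risk_le:
  assumes fX: "fX \<in> L2_densities" and feps: "feps \<in> L2_densities"
    and nz: "\<And>t. fourier_real feps t \<noteq> 0"
    and src: "source_fun s \<beta> feps fX \<in> L2"
    and \<alpha>: "0 < \<alpha>" "\<alpha> < 1" and \<beta>: "0 \<le> \<beta>"
    and est: "L2_estimator n (conv fX feps) T"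
    and cut: "\<And>y. y \<in> space (sample_law n (conv fX feps)) \<Longrightarrow> is_spectral_cutoff s \<alpha> feps (T y) (S y)"
  shows "sobolev_risk s n (conv fX feps) fX S \<le>
    ennreal (1 / (2 * pi * \<alpha>)) * L2_risk n (conv fX feps) T +
    ennreal (\<bar>ln \<alpha>\<bar> powr (- \<beta>)) * L2_sq (source_fun s \<beta> feps fX)"
proof -
  let ?M = "sample_law n (conv fX feps)" and ?fY = "\<lambda>x. complex_of_real (conv fX feps x)"
  let ?R = "ennreal (\<bar>ln \<alpha>\<bar> powr (- \<beta>)) * L2_sq (source_fun s \<beta> feps fX)"
  have [measurable]: "conv fX feps \<in> borel_measurable borel"
    using integrable_conv[OF L2_density_integrable(1)[OF fX] L2_density_integrable(1)[OF feps]]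
    by (auto dest: borel_measurable_integrable)
  interpret prob_space ?M
    by (intro prob_space_sample_law nn_integral_conv_L2_densities fX feps) simp
  have [measurable]: "(\<lambda>(y, x). T y x) \<in> borel_measurable (?M \<Otimes>\<^sub>M lborel)"
    using est by (simp add: L2_estimator_def)
  have [measurable]: "(\<lambda>y. L2_sq (\<lambda>x. T y x - ?fY x)) \<in> borel_measurable ?M"
    unfolding L2_sq_def by (rule lborel.borel_measurable_nn_integral) measurable
  have "sobolev_risk s n (conv fX feps) fX S \<le>
      (\<integral>\<^sup>+y. ennreal (1 / (2 * pi * \<alpha>)) * L2_sq (\<lambda>x. T y x - ?fY x) + ?R \<partial>?M)"
    unfolding sobolev_risk_def
    using est by (intro nn_integral_mono spectral_cutoff_sobolev_le fX feps nz src \<alpha> \<beta> cut)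
      (simp_all add: L2_estimator_def)
  also have "\<dots> = ennreal (1 / (2 * pi * \<alpha>)) * L2_risk n (conv fX feps) T + ?R"
    unfolding L2_risk_def by (simp add: nn_integral_add nn_integral_cmult emeasure_space_1)
  finally show ?thesis .
qed

text \<open>Where the inequality holds "as \<open>\<Delta> \<rightarrow> 0\<close>". The factor \<open>4\<close> leaves room for the constant \<open>c\<close>:
  \<open>|ln (c \<surd>\<Delta>)|\<close> is asymptotic to \<open>|ln \<Delta>| / 2\<close>, and it exceeds \<open>|ln \<Delta>| / 4\<close> once
  \<open>\<Delta> < c\<^sup>-\<^sup>4\<close>.\<close>

lemma small_noise_level:
  fixes \<beta> c :: real
  assumes c: "0 < c"
  shows "\<exists>\<delta>>0. \<forall>\<Delta>. 0 < \<Delta> \<and> \<Delta> < \<delta> \<longrightarrow>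
    c * sqrt \<Delta> < 1 \<and> \<bar>ln \<Delta>\<bar> \<le> 4 * \<bar>ln (c * sqrt \<Delta>)\<bar> \<and> 0 < \<bar>ln \<Delta>\<bar> \<and> sqrt \<Delta> \<le> \<bar>ln \<Delta>\<bar> powr (- \<beta>)"
proof -
  have "\<forall>\<^sub>F x in at_right 0. sqrt x \<le> \<bar>ln x\<bar> powr (- \<beta>)"
    by real_asymp
  moreover have "\<forall>\<^sub>F x in at_right 0. x < min 1 (1 / c ^ 4)"
    using c by (intro order_tendstoD(2)[OF tendsto_ident_at]) auto
  ultimately have "\<forall>\<^sub>F \<Delta> in at_right 0. c * sqrt \<Delta> < 1 \<and> \<bar>ln \<Delta>\<bar> \<le> 4 * \<bar>ln (c * sqrt \<Delta>)\<bar> \<and> 0 < \<bar>ln \<Delta>\<bar> \<and>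
      sqrt \<Delta> \<le> \<bar>ln \<Delta>\<bar> powr (- \<beta>)"
    using eventually_at_right_less[of "0 :: real"]
  proof eventually_elim
    fix x :: real
    assume pow: "sqrt x \<le> \<bar>ln x\<bar> powr (- \<beta>)" and x: "x < min 1 (1 / c ^ 4)" "0 < x"
    have "ln x < 0" using x by simp
    have "ln x < ln (1 / c ^ 4)" using x c by (subst ln_less_cancel_iff) auto
    also have "\<dots> = - 4 * ln c" using c by (simp add: ln_div ln_realpow)
    finally have "ln x + 4 * ln c < 0" by simp
    moreover have "ln (c * sqrt x) = ln c + ln x / 2"
      using c x by (simp add: ln_mult ln_sqrt)
    ultimately have "ln (c * sqrt x) < ln x / 4" by linarith
    with \<open>ln x < 0\<close> have "ln (c * sqrt x) < 0" "\<bar>ln x\<bar> \<le> 4 * \<bar>ln (c * sqrt x)\<bar>" by linarith+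
    moreover have "c * sqrt x < 1"
      using \<open>ln (c * sqrt x) < 0\<close> c x by simp
    ultimately show "c * sqrt x < 1 \<and> \<bar>ln x\<bar> \<le> 4 * \<bar>ln (c * sqrt x)\<bar> \<and> 0 < \<bar>ln x\<bar> \<and>
        sqrt x \<le> \<bar>ln x\<bar> powr (- \<beta>)"
      using pow \<open>ln x < 0\<close> by simp
  qed
  then show ?thesis
    unfolding eventually_at_right_field by auto
qed

theorem theorem3p4:
  fixes \<rho> \<beta> c :: real
  assumes "\<beta> > 0" and "c > 0"
  shows "\<exists>C>0. \<forall>(s::real) fX feps.
    s \<ge> 0 \<and> fX \<in> L2_densities \<and> feps \<in> L2_densities \<and>
    (\<forall>t. (cmod (fourier_real feps t))\<^sup>2 > 0) \<and>
    source_fun s \<beta> feps fX \<in> L2 \<and> L2_norm (source_fun s \<beta> feps fX) = \<rho> \<longrightarrow>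
    (\<exists>\<delta>>0. \<forall>(n::nat) fY_hat fX_tilde (\<Delta>::real).
       L2_estimator n (conv fX feps) fY_hat \<and>
       L2_risk n (conv fX feps) fY_hat = ennreal \<Delta> \<and> 0 < \<Delta> \<and> \<Delta> < \<delta> \<and>
       (\<forall>y \<in> space (sample_law n (conv fX feps)).
          is_spectral_cutoff s (c * sqrt \<Delta>) feps (fY_hat y) (fX_tilde y)) \<longrightarrow>
       sobolev_risk s n (conv fX feps) fX fX_tilde \<le> ennreal (C * \<bar>ln \<Delta>\<bar> powr (- \<beta>)))"
proof -
  \<comment> \<open>the variance contributes \<open>1 / (2\<pi>c)\<close>, the bias \<open>4\<^sup>\<beta> \<rho>\<^sup>2\<close>\<close>
  define C where "C = 1 / (2 * pi * c) + 4 powr \<beta> * \<rho>\<^sup>2"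
  have "C > 0"
    unfolding C_def using \<open>c > 0\<close> by (intro add_pos_nonneg) auto
  obtain \<delta> where "\<delta> > 0" and \<delta>: "\<And>\<Delta>. 0 < \<Delta> \<Longrightarrow> \<Delta> < \<delta> \<Longrightarrow>
      c * sqrt \<Delta> < 1 \<and> \<bar>ln \<Delta>\<bar> \<le> 4 * \<bar>ln (c * sqrt \<Delta>)\<bar> \<and> 0 < \<bar>ln \<Delta>\<bar> \<and> sqrt \<Delta> \<le> \<bar>ln \<Delta>\<bar> powr (- \<beta>)"
    using small_noise_level[OF \<open>c > 0\<close>, of \<beta>] by auto
  have "sobolev_risk s n (conv fX feps) fX fX_tilde \<le> ennreal (C * \<bar>ln \<Delta>\<bar> powr (- \<beta>))"
    if fX: "fX \<in> L2_densities" and feps: "feps \<in> L2_densities"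
      and pos: "\<forall>t. (cmod (fourier_real feps t))\<^sup>2 > 0"
      and src: "source_fun s \<beta> feps fX \<in> L2" "L2_norm (source_fun s \<beta> feps fX) = \<rho>"
      and est: "L2_estimator n (conv fX feps) fY_hat"
      and risk: "L2_risk n (conv fX feps) fY_hat = ennreal \<Delta>"
      and \<Delta>: "0 < \<Delta>" "\<Delta> < \<delta>"
      and cut: "\<forall>y \<in> space (sample_law n (conv fX feps)).
          is_spectral_cutoff s (c * sqrt \<Delta>) feps (fY_hat y) (fX_tilde y)"
    for s fX feps n fY_hat fX_tilde \<Delta>
  proof -
    let ?\<alpha> = "c * sqrt \<Delta>"
    note small = \<delta>[OF \<Delta>]
    have \<alpha>: "0 < ?\<alpha>" using \<open>c > 0\<close> \<Delta> by simp
    have src_sq: "L2_sq (source_fun s \<beta> feps fX) = ennreal (\<rho>\<^sup>2)"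
      using src by (cases "L2_sq (source_fun s \<beta> feps fX)") (auto simp: L2_norm_def L2_def)
    have "sobolev_risk s n (conv fX feps) fX fX_tilde \<le>
        ennreal (1 / (2 * pi * ?\<alpha>)) * ennreal \<Delta> + ennreal (\<bar>ln ?\<alpha>\<bar> powr (- \<beta>)) * ennreal (\<rho>\<^sup>2)"
      unfolding risk[symmetric] src_sq[symmetric]
      using small cut pos \<open>\<beta> > 0\<close> by (intro sobolev_risk_le fX feps src est \<alpha>) auto
    also have "\<dots> = ennreal (1 / (2 * pi * ?\<alpha>) * \<Delta> + \<bar>ln ?\<alpha>\<bar> powr (- \<beta>) * \<rho>\<^sup>2)"
      using \<alpha> \<Delta> by (subst ennreal_plus) (simp_all only: ennreal_mult' less_imp_le mult_nonneg_nonneg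
        powr_ge_zero zero_le_power2 divide_nonneg_nonneg zero_le_one pi_ge_zero zero_le_numeral)
    also have "\<dots> \<le> ennreal (C * \<bar>ln \<Delta>\<bar> powr (- \<beta>))"
    proof (rule ennreal_leI)
      have "1 / (2 * pi * ?\<alpha>) * \<Delta> = 1 / (2 * pi * c) * sqrt \<Delta>"
        using \<open>c > 0\<close> \<Delta> by (simp add: field_simps real_sqrt_mult_self)
      also have "\<dots> \<le> 1 / (2 * pi * c) * \<bar>ln \<Delta>\<bar> powr (- \<beta>)"
        using small \<open>c > 0\<close> by (intro mult_left_mono) auto
      finally have 1: "1 / (2 * pi * ?\<alpha>) * \<Delta> \<le> 1 / (2 * pi * c) * \<bar>ln \<Delta>\<bar> powr (- \<beta>)" .
      have "\<bar>ln ?\<alpha>\<bar> powr (- \<beta>) \<le> (\<bar>ln \<Delta>\<bar> / 4) powr (- \<beta>)"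
        using small \<open>\<beta> > 0\<close> by (intro powr_mono2') auto
      also have "\<dots> = 4 powr \<beta> * \<bar>ln \<Delta>\<bar> powr (- \<beta>)"
        by (simp add: powr_divide powr_minus field_simps)
      finally have "\<bar>ln ?\<alpha>\<bar> powr (- \<beta>) * \<rho>\<^sup>2 \<le> 4 powr \<beta> * \<bar>ln \<Delta>\<bar> powr (- \<beta>) * \<rho>\<^sup>2"
        by (rule mult_right_mono) simp
      with 1 show "1 / (2 * pi * ?\<alpha>) * \<Delta> + \<bar>ln ?\<alpha>\<bar> powr (- \<beta>) * \<rho>\<^sup>2 \<le> C * \<bar>ln \<Delta>\<bar> powr (- \<beta>)"
        unfolding C_def by (simp add: algebra_simps)
    qed
    finally show ?thesis .
  qed
  with \<open>C > 0\<close> \<open>\<delta> > 0\<close> show ?thesis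
    by (intro exI[of _ C] conjI allI impI exI[of _ \<delta>]) auto
qed

end
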